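(* Let $n\ge 1$ and $k\in\{1,\dots,n\}$ be integers, let $g\in C^1(\mathbb{R})$ be nonnegative and nonincreasing, and let $w\in C^1(\mathbb{R}^n\setminus\{0\})$ be a radial function satisfying the assumptions on $w$ given in the context, with $\gamma=\lim_{r\to+\infty} r w'(r)/w(r)$. Assume $$n>\frac{k(k+1)}{2k+\gamma}.$$ Let $u$ be a semi-stable nonconstant radial solution (not necessarily bounded) of $S_k(D^2u)=w(|x|)g(u)$ in $\mathbb{R}^n$. Then there exist $M>0$ and $r_0\ge 1$, depending on $u$ and $w$, such that for all $r\ge r_0$, $$|u(r)|\ \ge\ M\begin{cases} r^{\delta(r)} & \text{if } n\ne 2\left(k+\frac{2\gamma}{k}+4\right),\\ \log r & \text{if } n= 2\left(k+\frac{2\gamma}{k}+4\right),\end{cases}$$ where $\delta(r)$ is the exponent defined in the context.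
   Context: Radial functions are identified with functions of $r=|x|$, and $'$ denotes the derivative with respect to $r$. $k$-Hessian: $S_k(D^2u)$ is the sum of all $k$-th principal minors of the Hessian matrix $D^2u$, equivalently the $k$-th elementary symmetric polynomial of the eigenvalues of $D^2u$. Set $c_{n,k}=\binom{n}{k}/n$. Solutions: solutions are always taken in the class of $k$-admissible ($k$-convex) functions $\Phi^k=\{u\in C^2(\mathbb{R}^n): S_l(D^2u)\ge 0,\ l=1,\dots,k\}$. A radial solution is a radially symmetric $u\in\Phi^k$ satisfying the equation in $\mathbb{R}^n$. Semi-stability: a radial solution $u\in\Phi^k$ is semi-stable if $$\mathcal{Q}_u(\xi):=\int_{\mathbb{R}^n}\Big\{k c_{n,k}|x|^{1-k}|\nabla u|^{k-1}|\nabla \xi|^2+w(|x|)g'(u)\xi^2\Big\}\,dx\ \ge 0$$ for every radially symmetric $\xi\in C_c^1(\mathbb{R}^n)$. Assumptions on $w$: $w$ is a nonnegative radial function; put $W(r)=\frac{r w'(r)}{w(r)}$. The functions $w$ and $W$ belong to $C^1(\mathbb{R}^n\setminus\{0\})$, $W$ is nonincreasing on $(0,\infty)$, and the limits $\Gamma=\lim_{r\to0}W(r)$ and $\gamma=\lim_{r\to+\infty}W(r)$ are finite. Exponents: for $s>0$ let $v(s)=\frac{k-1+W(s)}{k+1}$. For $r\ge 1$ let $$\alpha(r)=\frac{1}{\log r}\int_1^r \frac{v(s)+\sqrt{v(s)^2+\frac{n}{k}v(s)+\frac{n}{k}-1-s v'(s)}}{s}\,ds,\qquad \delta(r)=\frac{-n+2\alpha(r)+2k+2}{k+1},$$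 the value at $r=1$ being understood as the limit $r\to1^+$. *)

theory Defs
  imports "HOL-Analysis.Analysis"
begin

definition gradient :: "(real^'n \<Rightarrow> real) \<Rightarrow> real^'n \<Rightarrow> real^'n"
  where "gradient f x = (\<chi> i. frechet_derivative f (at x) (axis i 1))"

definition hessian :: "(real^'n \<Rightarrow> real) \<Rightarrow> real^'n \<Rightarrow> real^'n^'n"
  where "hessian f x = jacobian (gradient f) (at x)"

(* Meant for open S only. *)
definition C1_on :: "(real^'n) set \<Rightarrow> (real^'n \<Rightarrow> real) \<Rightarrow> bool"
  where "C1_on S f \<longleftrightarrow> (\<forall>x\<in>S. f differentiable (at x)) \<and> continuous_on S (gradient f)"

definition C2 :: "(real^'n \<Rightarrow> real) \<Rightarrow> bool"
  where "C2 f \<longleftrightarrow> C1_on UNIV f \<and> (\<forall>x. gradient f differentiable (at x)) \<and>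
                continuous_on UNIV (hessian f)"

(* The Leibniz formula for the determinant of the submatrix of A with rows and columns in I. *)
definition principal_minor :: "real^'n^'n \<Rightarrow> 'n set \<Rightarrow> real"
  where "principal_minor A I = (\<Sum>p | p permutes I. of_int (sign p) * (\<Prod>i\<in>I. A $ i $ p i))"

definition sum_principal_minors :: "nat \<Rightarrow> real^'n^'n \<Rightarrow> real"
  where "sum_principal_minors k A = (\<Sum>I | card I = k. principal_minor A I)"

definition hessian_op :: "nat \<Rightarrow> (real^'n \<Rightarrow> real) \<Rightarrow> real^'n \<Rightarrow> real"
  where "hessian_op k u x = sum_principal_minors k (hessian u x)"

definition k_admissible :: "nat \<Rightarrow> (real^'n \<Rightarrow> real) set"
  where "k_admissible k = {u. C2 u \<and> (\<forall>l\<in>{1..k}. \<forall>x. hessian_op l u x \<ge> 0)}"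

definition radially_symmetric :: "(real^'n \<Rightarrow> real) \<Rightarrow> bool"
  where "radially_symmetric f \<longleftrightarrow> (\<forall>x y. norm x = norm y \<longrightarrow> f x = f y)"

(* The weight w is given by its profile on (0,\<infinity>) and need not be defined, or bounded, at the
   origin.  The equation is therefore required at x \<noteq> 0; where w extends continuously to the
   origin, it holds there by continuity. *)
definition radial_solution ::
    "nat \<Rightarrow> (real \<Rightarrow> real) \<Rightarrow> (real \<Rightarrow> real) \<Rightarrow> (real^'n \<Rightarrow> real) \<Rightarrow> bool"
  where "radial_solution k w g u \<longleftrightarrow>
           u \<in> k_admissible k \<and> radially_symmetric u \<and>
           (\<forall>x. x \<noteq> 0 \<longrightarrow> hessian_op k u x = w (norm x) * g (u x))"

definition binomial_const :: "nat \<Rightarrow> nat \<Rightarrow> real"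
  where "binomial_const n k = real (n choose k) / real n"

definition stability_integrand ::
    "nat \<Rightarrow> (real \<Rightarrow> real) \<Rightarrow> (real \<Rightarrow> real) \<Rightarrow> (real^'n \<Rightarrow> real) \<Rightarrow> (real^'n \<Rightarrow> real) \<Rightarrow> real^'n \<Rightarrow> real"
  where "stability_integrand k w g u \<xi> x =
           real k * binomial_const CARD('n) k * norm x powi (1 - int k) *
             norm (gradient u x) ^ (k - 1) * (norm (gradient \<xi> x))\<^sup>2 +
           w (norm x) * deriv g (u x) * (\<xi> x)\<^sup>2"

(* For radial u of class C2, w \<ge> 0 and g nonincreasing, the first summand is integrable and the
   second is nonpositive, so the integral exists in [-\<infinity>,\<infinity>) and Q_u(\<xi>) \<ge> 0 includes its
   finiteness.  Since Isabelle's integral of a non-integrable function is 0, integrability is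
   stated explicitly. *)
definition semi_stable ::
    "nat \<Rightarrow> (real \<Rightarrow> real) \<Rightarrow> (real \<Rightarrow> real) \<Rightarrow> (real^'n \<Rightarrow> real) \<Rightarrow> bool"
  where "semi_stable k w g u \<longleftrightarrow>
           (\<forall>\<xi>. C1_on UNIV \<xi> \<and> compact (closure {x. \<xi> x \<noteq> 0}) \<and> radially_symmetric \<xi> \<longrightarrow>
              integrable lborel (stability_integrand k w g u \<xi>) \<and>
              (LINT x|lborel. stability_integrand k w g u \<xi> x) \<ge> 0)"

definition log_slope :: "(real \<Rightarrow> real) \<Rightarrow> real \<Rightarrow> real"
  where "log_slope w r = r * deriv w r / w r"

definition v_fun :: "nat \<Rightarrow> (real \<Rightarrow> real) \<Rightarrow> real \<Rightarrow> real"
  where "v_fun k w s = (real k - 1 + log_slope w s) / (real k + 1)"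

definition radicand :: "nat \<Rightarrow> nat \<Rightarrow> (real \<Rightarrow> real) \<Rightarrow> real \<Rightarrow> real"
  where "radicand n k w s =
           (v_fun k w s)\<^sup>2 + real n / real k * v_fun k w s + real n / real k - 1
             - s * deriv (v_fun k w) s"

definition alpha_avg :: "nat \<Rightarrow> nat \<Rightarrow> (real \<Rightarrow> real) \<Rightarrow> real \<Rightarrow> real"
  where "alpha_avg n k w r =
           1 / ln r * integral {1..r} (\<lambda>s. (v_fun k w s + sqrt (radicand n k w s)) / s)"

definition alpha :: "nat \<Rightarrow> nat \<Rightarrow> (real \<Rightarrow> real) \<Rightarrow> real \<Rightarrow> real"
  where "alpha n k w r =
           (if r = 1 then Lim (at_right 1) (alpha_avg n k w) else alpha_avg n k w r)"

definition delta :: "nat \<Rightarrow> nat \<Rightarrow> (real \<Rightarrow> real) \<Rightarrow> real \<Rightarrow> real"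
  where "delta n k w r =
           (- real n + 2 * alpha n k w r + 2 * real k + 2) / (real k + 1)"

(* When 2k + \<gamma> > 0, the condition n > k(k+1)/(2k+\<gamma>) makes the square root in alpha real on
   (0,\<infinity>).  For 2k + \<gamma> < 0 that condition is vacuous and the radicand may be negative. *)
lemma radicand_nonneg:
  assumes k: "k \<ge> 1"
    and anti: "antimono_on {0<..} (log_slope w)"
    and lim: "(log_slope w \<longlongrightarrow> \<gamma>) at_top"
    and diff: "\<And>r. r > 0 \<Longrightarrow> log_slope w differentiable (at r)"
    and pos: "2 * real k + \<gamma> > 0"
    and dim: "real n > real k * (real k + 1) / (2 * real k + \<gamma>)"
    and s: "s > 0"
  shows "radicand n k w s \<ge> 0"
proof -
  let ?W = "log_slope w" and ?v = "v_fun k w"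
  have ge: "?W s \<ge> \<gamma>"
  proof (rule tendsto_upperbound[OF lim])
    show "\<forall>\<^sub>F r in at_top. ?W r \<le> ?W s"
      using eventually_ge_at_top[of s]
      by eventually_elim (use anti s in \<open>auto simp: monotone_on_def\<close>)
  qed simp
  obtain D where D: "(?W has_real_derivative D) (at s)"
    using diff[OF s] by (auto simp: real_differentiable_def)
  have "D \<le> 0"
  proof (rule ccontr)
    assume "\<not> D \<le> 0"
    then obtain d where d: "d > 0" "\<And>h. h > 0 \<Longrightarrow> h < d \<Longrightarrow> ?W s < ?W (s + h)"
      using DERIV_pos_inc_right[OF D] by auto
    have "?W s < ?W (s + d/2)" using d by simp
    moreover have "?W (s + d/2) \<le> ?W s"
      using anti s d(1) by (auto simp: monotone_on_def)
    ultimately show False by simp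
  qed
  have "(?v has_real_derivative D / (real k + 1)) (at s)"
    unfolding v_fun_def[abs_def] by (auto intro!: derivative_eq_intros D)
  then have "deriv ?v s = D / (real k + 1)" by (rule DERIV_imp_deriv)
  with \<open>D \<le> 0\<close> s have dv: "s * deriv ?v s \<le> 0"
    by (simp add: mult_nonneg_nonpos divide_nonpos_pos)
  have W: "2 * real k + ?W s = (?v s + 1) * (real k + 1)"
    unfolding v_fun_def by (simp add: field_simps)
  have "real k * (real k + 1) < real n * (2 * real k + \<gamma>)"
    using dim pos by (simp add: pos_divide_less_eq)
  also have "\<dots> \<le> real n * (2 * real k + ?W s)"
    using ge by (intro mult_left_mono) auto
  finally have "real k * (real k + 1) < (real n * (?v s + 1)) * (real k + 1)"
    unfolding W by (simp only: mult.assoc)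
  then have "real k < real n * (?v s + 1)"
    by (rule mult_right_less_imp_less) simp
  then have "1 \<le> real n * (?v s + 1) / real k"
    using k by (subst pos_le_divide_eq) auto
  moreover have "real n * (?v s + 1) / real k = real n / real k * ?v s + real n / real k"
    by (simp add: distrib_left add_divide_distrib)
  ultimately have "real n / real k * ?v s + real n / real k - 1 \<ge> 0"
    by linarith
  then show ?thesis unfolding radicand_def using dv zero_le_power2[of "?v s"] by linarith
qed

end

(* Write u(x) = U(|x|), p = U' and v for v_fun k w. The equation says that A = r^(n-k) p^k is
   nondecreasing. Testing stability with p \<eta> and eliminating g'(u) by means of the differentiated
   equation turns it, up to a total derivative, into
     0 \<le> \<integral> r^(n-k-2) p^(k+1) ((r \<eta>' + v \<eta>)^2 - R \<eta>^2) dr,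
   where R is the radicand in the exponent \<alpha>. If 2k + \<gamma> > 0, then R > v^2, so the integrand is
   negative where \<eta> is constant, and r^(-\<alpha>) solves r \<eta>' = -(v + sqrt R) \<eta>, for which it vanishes.
   Taking \<eta> constant near the origin, equal to a multiple of r^(-\<alpha>) for 2 \<le> r \<le> \<rho> and cut off on
   [\<rho>, 2\<rho>], the negative part near the origin has to be compensated on [\<rho>, 2\<rho>], which together
   with the monotonicity of A gives p(r) \<ge> c r^(\<delta>-1).
   If 2k + \<gamma> < 0, then r^\<delta> is O(r^(2-n/k)) and the monotonicity of A alone gives
   p(r) \<ge> c r^(1-n/k). The bound on |U| follows by integration over [r/2, r] or [r, 2r]. *)
theory Submission
  imports Defs
begin

section \<open>Integration of radial functions\<close>

text \<open>The obstacle is the term -s v'(s) in R: it has no pointwise upper bound. What is known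
  is that v decreases from its limit at 0 to its limit at infinity, so that -v' has integral at most
  \<open>q0 - q\<close> over any interval. Upper bounds on sqrt R and on \<open>y\<close> are
  therefore brought to the form C - D s v'(s) before they are integrated against ds/s, and
  r^\<delta> is compared at different radii only within one dyadic interval. The exponent \<delta>
  is dictated by the outer cutoff. With E = \<alpha> ln, the integral over [\<rho>, 2\<rho>] has
  size \<rho>^(n-k-1) p^(k+1) exp(-2E) and must exceed a fixed positive constant; this is the
  (k+1)-st power of p \<ge> c \<rho>^(\<delta>-1). Test functions are also kept away from the
  origin, where w may be singular. The price is a second cutoff at radius \<epsilon>, which costs
  only O(\<epsilon>) because p(0) = 0 and is paid out of the gain on the plateau. The exceptional
  dimension in the statement is the one where \<delta>(r) tends to 0, so that integrating p \<ge>
  c/r yields a logarithm.\<close>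

lemma distr_norm_lborel:
  "distr lborel borel (norm :: 'a::euclidean_space \<Rightarrow> real) =
     density lborel (\<lambda>r. ennreal (indicator {0<..} r *
       (real DIM('a) * unit_ball_vol (real DIM('a)) * r ^ (DIM('a) - 1))))"
    (is "?M = ?N")
proof (rule measure_eqI_generator_eq[where E = "range (\<lambda>a::real. {..a})" and \<Omega> = UNIV
        and A = "\<lambda>i::nat. {..real i}"])
  let ?n = "DIM('a)" and ?\<omega> = "unit_ball_vol (real DIM('a))"
  \<comment> \<open>Half-lines generate the Borel sets, so distribution functions suffice: the
    volume of a ball on one side, the power rule on the other.\<close>
  have cdfM: "emeasure ?M {..a} = (if a < 0 then 0 else ennreal (?\<omega> * a ^ ?n))" for a
  proof -
    have "emeasure ?M {..a} = emeasure lborel (cball (0::'a) a)"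
      by (subst emeasure_distr) (auto intro!: arg_cong[where f = "emeasure lborel"])
    then show ?thesis by (auto simp: emeasure_cball)
  qed
  have cdfN: "emeasure ?N {..a} = (if a < 0 then 0 else ennreal (?\<omega> * a ^ ?n))" for a
  proof -
    have "emeasure ?N {..a} = (\<integral>\<^sup>+ r. ennreal (real ?n * ?\<omega> * r ^ (?n - 1)) * indicator {0..a} r \<partial>lborel)"
    proof (subst emeasure_density, simp_all, rule nn_integral_cong_AE)
      \<comment> \<open>The density lives on r > 0, the antiderivative on a closed interval. In
        dimension one the integrand does not vanish at 0, so the two differ there, on a null
        set.\<close>
      have "AE r in lborel. r \<noteq> (0::real)" by (rule AE_lborel_singleton)
      then show "AE r in lborel. ennreal (indicator {0<..} r * (real ?n * ?\<omega> * r ^ (?n - Suc 0))) *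
           indicator {..a} r = ennreal (real ?n * ?\<omega> * r ^ (?n - Suc 0)) * indicator {0..a} r"
        by eventually_elim (auto simp: indicator_def)
    qed
    also have "\<dots> = (if a < 0 then 0 else ennreal (?\<omega> * a ^ ?n))"
    proof (cases "a < 0")
      case False
      have "(\<integral>\<^sup>+ r. ennreal (real ?n * ?\<omega> * r ^ (?n - 1)) * indicator {0..a} r \<partial>lborel) =
              ennreal (?\<omega> * a ^ ?n - ?\<omega> * 0 ^ ?n)"
        using False
        by (intro nn_integral_FTC_Icc) (auto intro!: derivative_eq_intros simp: has_real_derivative_iff_has_vector_derivative[symmetric])
      then show ?thesis using False by simp
    qed simp
    finally show ?thesis .
  qed
  show "Int_stable (range (\<lambda>a::real. {..a}))"
    by (auto simp: Int_stable_def)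
  show "emeasure ?M X = emeasure ?N X" if "X \<in> range (\<lambda>a::real. {..a})" for X
  proof -
    from that obtain a where "X = {..a}" by blast
    then show ?thesis by (simp only: cdfM cdfN)
  qed
  show "sets ?M = sigma_sets UNIV (range atMost)"
    by (simp add: borel_eq_atMost)
  show "sets ?N = sigma_sets UNIV (range atMost)"
    by (simp add: borel_eq_atMost)
  show "(\<Union>i. {..real i}) = UNIV"
    using real_arch_simple by auto
  show "emeasure ?M {..real i} \<noteq> \<infinity>" for i by (simp add: cdfM)
qed auto

lemma integral_norm_lborel:
  fixes F :: "real \<Rightarrow> real"
  assumes "0 < a" and cont: "continuous_on {a..b} F" and zero: "\<And>r. r \<notin> {a..b} \<Longrightarrow> F r = 0"
  shows "(LINT x|lborel. F (norm (x::'a::euclidean_space))) =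
           real DIM('a) * unit_ball_vol (real DIM('a)) * integral {a..b} (\<lambda>r. r ^ (DIM('a) - 1) * F r)"
proof -
  let ?n = "DIM('a)" and ?\<omega> = "unit_ball_vol (real DIM('a))"
  have F_eq: "F = (\<lambda>r. indicator {a..b} r *\<^sub>R F r)"
    using zero by (intro ext) (auto simp: indicator_def)
  have F_meas: "F \<in> borel_measurable borel"
    by (subst F_eq) (rule borel_measurable_continuous_on_indicator[OF _ cont], simp)
  have "(LINT x|lborel. F (norm (x::'a))) = (LINT r|distr lborel borel (norm :: 'a \<Rightarrow> real). F r)"
    by (subst integral_distr) (use F_meas in auto)
  also have "\<dots> = (LINT r|lborel. (indicator {0<..} r * (real ?n * ?\<omega> * r ^ (?n - 1))) * F r)"
    unfolding distr_norm_lborel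
    by (subst integral_real_density) (use F_meas in \<open>auto simp: indicator_def\<close>)
  also have "\<dots> = (LINT r:{a..b}|lborel. real ?n * ?\<omega> * (r ^ (?n - 1) * F r))"
    unfolding set_lebesgue_integral_def using \<open>0 < a\<close> zero
    by (intro Bochner_Integration.integral_cong) (auto simp: indicator_def)
  also have "\<dots> = integral {a..b} (\<lambda>r. real ?n * ?\<omega> * (r ^ (?n - 1) * F r))"
    by (intro set_borel_integral_eq_integral(2) borel_integrable_atLeastAtMost' continuous_intros cont)
  finally show ?thesis by simp
qed

section \<open>Calculus of radial functions\<close>

lemma has_derivative_gradient:
  assumes "f differentiable (at x)"
  shows "(f has_derivative (\<lambda>h. gradient f x \<bullet> h)) (at x)"
proof -
  have D: "(f has_derivative frechet_derivative f (at x)) (at x)"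
    using assms by (simp add: frechet_derivative_works)
  have lin: "linear (frechet_derivative f (at x))"
    by (rule has_derivative_linear[OF D])
  have "frechet_derivative f (at x) h = gradient f x \<bullet> h" for h
  proof -
    have "frechet_derivative f (at x) h = frechet_derivative f (at x) (\<Sum>i\<in>UNIV. h $ i *\<^sub>R axis i 1)"
      using basis_expansion[of h] by (simp add: scalar_mult_eq_scaleR)
    also have "\<dots> = gradient f x \<bullet> h"
      by (simp add: linear_sum[OF lin] linear_cmul[OF lin] gradient_def inner_vec_def mult.commute)
    finally show ?thesis .
  qed
  then have "frechet_derivative f (at x) = (\<lambda>h. gradient f x \<bullet> h)" by auto
  then show ?thesis using D by simp
qed

lemma gradient_eqI:
  assumes "(f has_derivative (\<lambda>h. a \<bullet> h)) (at x)"
  shows "gradient f x = a"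
  unfolding gradient_def frechet_derivative_at[OF assms, symmetric]
  by (simp add: vec_eq_iff inner_axis)

lemma has_derivative_radial:
  fixes x :: "'a::real_inner"
  assumes "x \<noteq> 0" and "(f has_real_derivative d) (at (norm x))"
  shows "((\<lambda>x. f (norm x)) has_derivative (\<lambda>h. (d / norm x) *\<^sub>R x \<bullet> h)) (at x)"
proof -
  have "((\<lambda>x. f (norm x)) has_derivative (\<lambda>h. d * (sgn x \<bullet> h))) (at x)"
    using has_derivative_compose[OF has_derivative_norm[OF assms(1)], of f "(*) d"] assms(2)
    by (simp add: has_field_derivative_def inner_commute)
  then show ?thesis
    by (simp add: sgn_div_norm field_simps)
qed

text \<open>On the ray spanned by a coordinate vector e, the derivative of the profile at t is the
  component along e of the gradient at t e, hence continuous in t.\<close>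

lemma radial_C1_profile:
  fixes f :: "real \<Rightarrow> real"
  assumes "C1_on (- {0}) (\<lambda>x::real^'n. f (norm x))"
  shows "\<And>t. t > 0 \<Longrightarrow> (f has_real_derivative deriv f t) (at t)"
    and "continuous_on {0<..} (deriv f)"
proof -
  let ?F = "\<lambda>x::real^'n. f (norm x)"
  fix i :: 'n
  let ?e = "axis i 1 :: real^'n"
  have ne: "t *\<^sub>R ?e \<noteq> 0" if "t > 0" for t
    using that by (simp add: axis_eq_0_iff)
  have D: "(f has_real_derivative gradient ?F (t *\<^sub>R ?e) \<bullet> ?e) (at t)" if "t > 0" for t
  proof -
    have "((\<lambda>s. s *\<^sub>R ?e) has_derivative (\<lambda>h. h *\<^sub>R ?e)) (at t)"
      by (auto intro!: derivative_eq_intros)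
    moreover have "(?F has_derivative (\<lambda>h. gradient ?F (t *\<^sub>R ?e) \<bullet> h)) (at (t *\<^sub>R ?e))"
      using assms ne[OF that] by (intro has_derivative_gradient) (auto simp: C1_on_def)
    ultimately have "((\<lambda>s. ?F (s *\<^sub>R ?e)) has_derivative (\<lambda>h. gradient ?F (t *\<^sub>R ?e) \<bullet> (h *\<^sub>R ?e))) (at t)"
      by (rule has_derivative_compose)
    then have "((\<lambda>s. ?F (s *\<^sub>R ?e)) has_real_derivative gradient ?F (t *\<^sub>R ?e) \<bullet> ?e) (at t)"
      by (simp add: has_field_derivative_def mult_commute_abs)
    then show ?thesis
      by (rule has_field_derivative_transform_within_open[where S = "{0<..}"]) (use that in auto)
  qed
  show "(f has_real_derivative deriv f t) (at t)" if "t > 0" for t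
    using D[OF that] DERIV_imp_deriv[OF D[OF that]] by simp
  have "continuous_on {0<..} (\<lambda>t. gradient ?F (t *\<^sub>R ?e) \<bullet> ?e)"
  proof -
    have "continuous_on (- {0}) (gradient ?F)" using assms by (simp add: C1_on_def)
    then show ?thesis using ne
      by (intro continuous_intros continuous_on_compose2[of "- {0}" "gradient ?F" "{0<..}" "\<lambda>t. t *\<^sub>R ?e"]) auto
  qed
  then show "continuous_on {0<..} (deriv f)"
    by (rule continuous_on_eq) (use DERIV_imp_deriv[OF D] in auto)
qed

text \<open>The profile is read off along a whole line through the origin, so it is even and its
  derivative vanishes at 0; all derivatives are two-sided.\<close>

lemma C2_radial_profile:
  fixes u :: "real^'n \<Rightarrow> real"
  assumes C2: "C2 u" and rad: "radially_symmetric u"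
  obtains U p p' where
    "\<And>x. u x = U (norm x)" "\<And>t. (U has_real_derivative p t) (at t)"
    "\<And>t. (p has_real_derivative p' t) (at t)" "continuous_on UNIV p'" "p 0 = 0"
proof -
  fix i :: 'n
  let ?e = "axis i 1 :: real^'n"
  define U where "U t = u (t *\<^sub>R ?e)" for t
  define p where "p t = gradient u (t *\<^sub>R ?e) \<bullet> ?e" for t
  define p' where "p' t = hessian u (t *\<^sub>R ?e) $ i $ i" for t
  have line: "((\<lambda>s. s *\<^sub>R ?e) has_derivative (\<lambda>h. h *\<^sub>R ?e)) (at t)" for t
    by (auto intro!: derivative_eq_intros)
  have u_eq: "u x = U (norm x)" for x
  proof -
    have "norm x = norm (norm x *\<^sub>R ?e)" by simp
    then show ?thesis using rad unfolding U_def radially_symmetric_def by blast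
  qed
  have U: "(U has_real_derivative p t) (at t)" for t
  proof -
    have "(u has_derivative (\<lambda>h. gradient u (t *\<^sub>R ?e) \<bullet> h)) (at (t *\<^sub>R ?e))"
      using C2 by (intro has_derivative_gradient) (auto simp: C2_def C1_on_def)
    from has_derivative_compose[OF line this] show ?thesis
      unfolding U_def p_def by (simp add: has_field_derivative_def mult_commute_abs)
  qed
  have p: "(p has_real_derivative p' t) (at t)" for t
  proof -
    have "(gradient u has_derivative (\<lambda>h. hessian u (t *\<^sub>R ?e) *v h)) (at (t *\<^sub>R ?e))"
      using C2 unfolding hessian_def by (simp add: C2_def jacobian_works)
    from has_derivative_inner_left[OF has_derivative_compose[OF line this], of ?e] show ?thesis
      unfolding p_def p'_def
      by (simp add: has_field_derivative_def mult_commute_abs matrix_vector_mult_scaleR inner_axis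
          matrix_vector_mult_basis column_def)
  qed
  have p': "continuous_on UNIV p'"
    using C2 unfolding p'_def C2_def
    by (auto intro!: continuous_intros continuous_on_compose2[of UNIV "hessian u"])
  have "U (- t) = U t" for t
    using u_eq[of "t *\<^sub>R ?e"] u_eq[of "(- t) *\<^sub>R ?e"] unfolding U_def by simp
  then have "(\<lambda>t. U (- t)) = U" by auto
  then have "p 0 = - p 0"
    using DERIV_unique[of U "- p 0" 0 "p 0"] U[of 0] DERIV_mirror[of U "p 0" 0] by simp
  then show thesis
    using that[of U p p'] u_eq U p p' by simp
qed

section \<open>Hessian operators of radial functions\<close>

lemma principal_minor_diagonal:
  assumes "\<And>i j. i \<noteq> j \<Longrightarrow> A $ i $ j = 0"
  shows "principal_minor A I = (\<Prod>i\<in>I. A $ i $ i)"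
proof -
  have "of_int (sign q) * (\<Prod>i\<in>I. A $ i $ q i) = (if q = id then \<Prod>i\<in>I. A $ i $ i else 0)"
    if "q permutes I" for q
  proof (cases "q = id")
    case False
    then obtain i where "q i \<noteq> i" by (auto simp: fun_eq_iff)
    then have i: "i \<in> I" "q i \<noteq> i" using permutes_not_in[OF that] by auto
    then have "(\<Prod>i\<in>I. A $ i $ q i) = 0"
      using assms[of i "q i"] by (intro prod_zero) auto
    with False show ?thesis by simp
  qed (simp add: sign_id)
  then have "principal_minor A I =
      (\<Sum>q | q permutes I. if q = id then \<Prod>i\<in>I. A $ i $ i else 0)"
    unfolding principal_minor_def by (intro sum.cong) auto
  also have "\<dots> = (\<Prod>i\<in>I. A $ i $ i)"
    by (subst sum.delta) (auto simp: finite_permutations permutes_id)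
  finally show ?thesis .
qed

text \<open>A radial Hessian has one radial eigenvalue a and otherwise the tangential eigenvalue b.
  The index sets are sorted by whether they contain the radial direction.\<close>

lemma elementary_symmetric_one_distinguished:
  fixes a b :: real and i0 :: "'n::finite"
  assumes "1 \<le> l"
  shows "(\<Sum>I::'n set | card I = l. \<Prod>i\<in>I. if i = i0 then a else b) =
     real (CARD('n) - 1 choose (l - 1)) * a * b ^ (l - 1) + real (CARD('n) - 1 choose l) * b ^ l"
proof -
  let ?A = "{I::'n set. card I = l \<and> i0 \<in> I}" and ?B = "{I::'n set. card I = l \<and> i0 \<notin> I}"
  have B_eq: "?B = {I. I \<subseteq> UNIV - {i0} \<and> card I = l}" by auto
  have cardB: "card ?B = CARD('n) - 1 choose l"
    unfolding B_eq by (subst n_subsets) auto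
  have A_eq: "?A = insert i0 ` {J. J \<subseteq> UNIV - {i0} \<and> card J = l - 1}" (is "_ = _ ` ?J")
  proof (intro equalityI subsetI)
    fix I assume "I \<in> ?A"
    then have "I = insert i0 (I - {i0})" "I - {i0} \<in> ?J" by auto
    then show "I \<in> insert i0 ` ?J" by blast
  qed (use assms in \<open>auto simp: card_insert_if\<close>)
  have "inj_on (insert i0) ?J"
    by (auto simp: inj_on_def)
  then have cardA: "card ?A = CARD('n) - 1 choose (l - 1)"
    unfolding A_eq by (subst card_image) (simp_all add: n_subsets)
  have "(\<Sum>I::'n set | card I = l. \<Prod>i\<in>I. if i = i0 then a else b) =
     (\<Sum>I\<in>?A. \<Prod>i\<in>I. if i = i0 then a else b) + (\<Sum>I\<in>?B. \<Prod>i\<in>I. if i = i0 then a else b)"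
    by (subst sum.union_disjoint[symmetric]) (auto intro!: sum.cong)
  also have "(\<Sum>I\<in>?A. \<Prod>i\<in>I. if i = i0 then a else b) = (\<Sum>I\<in>?A. a * b ^ (l - 1))"
  proof (rule sum.cong[OF refl])
    fix I assume I: "I \<in> ?A"
    then have "(\<Prod>i\<in>I. if i = i0 then a else b) = a * (\<Prod>i\<in>I - {i0}. if i = i0 then a else b)"
      by (subst prod.remove[of _ i0]) auto
    also have "(\<Prod>i\<in>I - {i0}. if i = i0 then a else b) = (\<Prod>i\<in>I - {i0}. b)"
      by (intro prod.cong) auto
    finally show "(\<Prod>i\<in>I. if i = i0 then a else b) = a * b ^ (l - 1)"
      using I by simp
  qed
  also have "(\<Sum>I\<in>?B. \<Prod>i\<in>I. if i = i0 then a else b) = (\<Sum>I\<in>?B. b ^ l)"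
  proof (rule sum.cong[OF refl])
    fix I assume I: "I \<in> ?B"
    then have "(\<Prod>i\<in>I. if i = i0 then a else b) = (\<Prod>i\<in>I. b)"
      by (intro prod.cong) auto
    then show "(\<Prod>i\<in>I. if i = i0 then a else b) = b ^ l" using I by simp
  qed
  finally show ?thesis by (simp add: cardA cardB)
qed

text \<open>On a coordinate axis the Hessian is already diagonal, with p' in the radial direction
  and p/t in all others, so neither rotations nor eigenvalues have to be discussed.\<close>

lemma hessian_op_radial:
  fixes u :: "real^'n \<Rightarrow> real"
  assumes u: "\<And>x. u x = U (norm x)" and U: "\<And>t. (U has_real_derivative p t) (at t)"
    and p: "\<And>t. (p has_real_derivative p' t) (at t)"
    and l: "1 \<le> l" and t: "t > 0"
  shows "hessian_op l u (t *\<^sub>R axis i0 1) =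
     real (CARD('n) - 1 choose (l - 1)) * p' t * (p t / t) ^ (l - 1)
     + real (CARD('n) - 1 choose l) * (p t / t) ^ l"
proof -
  let ?e = "axis i0 1 :: real^'n" let ?x = "t *\<^sub>R ?e"
  define d where "d = (p' t - p t / t) / t"
  have norm_x: "norm ?x = t" using t by simp
  have x0: "?x \<noteq> 0" using t by (simp add: axis_eq_0_iff)
  have u_eq: "u = (\<lambda>x. U (norm x))" using u by auto
  have grad: "gradient u x = (p (norm x) / norm x) *\<^sub>R x" if "x \<noteq> 0" for x
    unfolding u_eq by (rule gradient_eqI[OF has_derivative_radial[OF that U]])
  have "((\<lambda>s. p s / s) has_real_derivative d) (at (norm ?x))"
    unfolding norm_x d_def using t
    by (auto intro!: derivative_eq_intros p simp: field_simps power2_eq_square)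
  note has_derivative_scaleR[OF has_derivative_radial[OF x0 this] has_derivative_ident]
  then have "((\<lambda>x. (p (norm x) / norm x) *\<^sub>R x) has_derivative
       (\<lambda>h. (p t / t) *\<^sub>R h + (d * (?e \<bullet> h)) *\<^sub>R ?x)) (at ?x)"
    unfolding norm_x using t by simp
  then have "(gradient u has_derivative (\<lambda>h. (p t / t) *\<^sub>R h + (d * (?e \<bullet> h)) *\<^sub>R ?x)) (at ?x)"
    by (rule has_derivative_transform_within_open[where s = "- {0}"]) (use x0 grad in auto)
  note fd = frechet_derivative_at[OF this, symmetric]
  have H: "hessian u ?x $ i $ j = (if i = j then if i = i0 then p' t else p t / t else 0)" for i j
  proof -
    have "hessian u ?x $ i $ j = (p t / t) * axis j 1 $ i + d * (?e \<bullet> axis j 1) * (t * ?e $ i)"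
      unfolding hessian_def jacobian_def matrix_def fd by simp
    also have "\<dots> = (p t / t) * (if i = j then 1 else 0) + d * (if i0 = j then 1 else 0) * (t * (if i = i0 then 1 else 0))"
      by (simp add: inner_axis_axis) (simp add: axis_def)
    also have "\<dots> = (if i = j then if i = i0 then p' t else p t / t else 0)"
      using t by (simp add: d_def)
    finally show ?thesis .
  qed
  have "hessian_op l u ?x = (\<Sum>I | card I = l. \<Prod>i\<in>I. if i = i0 then p' t else p t / t)"
    unfolding hessian_op_def sum_principal_minors_def
    by (intro sum.cong refl) (simp add: principal_minor_diagonal H)
  then show ?thesis
    unfolding elementary_symmetric_one_distinguished[OF l] .
qed

text \<open>Vanishing on the ball of radius a removes the singularity of the norm at 0. Continuity
  of the gradient is glued from two open sets, the punctured space and that ball.\<close>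

lemma radial_test_function:
  fixes \<psi> \<psi>' :: "real \<Rightarrow> real"
  assumes a: "0 < a" and D: "\<And>t. (\<psi> has_real_derivative \<psi>' t) (at t)"
    and cont: "continuous_on UNIV \<psi>'" and supp: "\<And>t. t \<notin> {a..b} \<Longrightarrow> \<psi> t = 0"
  shows "C1_on UNIV (\<lambda>x::real^'n. \<psi> (norm x))"
    and "compact (closure {x::real^'n. \<psi> (norm x) \<noteq> 0})"
    and "radially_symmetric (\<lambda>x::real^'n. \<psi> (norm x))"
    and "\<And>x::real^'n. x \<noteq> 0 \<Longrightarrow> norm (gradient (\<lambda>x. \<psi> (norm x)) x) = \<bar>\<psi>' (norm x)\<bar>"
    and "gradient (\<lambda>x::real^'n. \<psi> (norm x)) 0 = 0"
proof -
  let ?\<xi> = "\<lambda>x::real^'n. \<psi> (norm x)"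
  have D1: "(?\<xi> has_derivative (\<lambda>h. (\<psi>' (norm x) / norm x) *\<^sub>R x \<bullet> h)) (at x)" if "x \<noteq> 0" for x
    by (rule has_derivative_radial[OF that D])
  have D0: "(?\<xi> has_derivative (\<lambda>h. 0 \<bullet> h)) (at x)" if "x \<in> ball 0 a" for x
    by (rule has_derivative_transform_within_open[of "\<lambda>x. 0" _ x UNIV "ball 0 a"]) (use that supp in auto)
  have grad1: "gradient ?\<xi> x = (\<psi>' (norm x) / norm x) *\<^sub>R x" if "x \<noteq> 0" for x
    by (rule gradient_eqI[OF D1[OF that]])
  have grad0: "gradient ?\<xi> x = 0" if "x \<in> ball 0 a" for x
    by (rule gradient_eqI[OF D0[OF that]])
  have "?\<xi> differentiable (at x)" for x
  proof (cases "x = 0")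
    case True
    then have "x \<in> ball 0 a" using a by simp
    from D0[OF this] show ?thesis unfolding differentiable_def by blast
  next
    case False
    from D1[OF this] show ?thesis unfolding differentiable_def by blast
  qed
  moreover have "continuous_on (- {0} \<union> ball 0 a) (gradient ?\<xi>)"
  proof (rule continuous_on_open_Un)
    have "continuous_on (- {0}) (\<lambda>x::real^'n. (\<psi>' (norm x) / norm x) *\<^sub>R x)"
      by (intro continuous_intros continuous_on_compose2[OF cont]) auto
    then show "continuous_on (- {0}) (gradient ?\<xi>)"
      by (rule continuous_on_eq) (use grad1 in auto)
    show "continuous_on (ball 0 a) (gradient ?\<xi>)"
      by (rule continuous_on_eq[of _ "\<lambda>x. 0"]) (use grad0 in auto)
  qed auto
  moreover have "- {0} \<union> ball 0 a = (UNIV :: (real^'n) set)" using a by auto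
  ultimately show "C1_on UNIV ?\<xi>" unfolding C1_on_def by simp
  have "{x. ?\<xi> x \<noteq> 0} \<subseteq> cball 0 b" using supp by fastforce
  then show "compact (closure {x. ?\<xi> x \<noteq> 0})"
    using bounded_subset[OF bounded_cball] by (simp add: compact_closure)
  show "radially_symmetric ?\<xi>" by (simp add: radially_symmetric_def)
  show "norm (gradient ?\<xi> x) = \<bar>\<psi>' (norm x)\<bar>" if "x \<noteq> 0" for x
    using grad1[OF that] that by simp
  show "gradient ?\<xi> 0 = 0" using a by (intro grad0) simp
qed

section \<open>The weight and the exponent\<close>

lemma DERIV_antimono_nonpos:
  fixes f :: "real \<Rightarrow> real"
  assumes anti: "antimono_on S f" and S: "open S" "s \<in> S" and D: "(f has_real_derivative D) (at s)"
  shows "D \<le> 0"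
proof (rule ccontr)
  assume "\<not> D \<le> 0"
  then obtain d where d: "d > 0" "\<And>h. h > 0 \<Longrightarrow> h < d \<Longrightarrow> f s < f (s + h)"
    using DERIV_pos_inc_right[OF D] by auto
  obtain e where e: "e > 0" "ball s e \<subseteq> S"
    using S openE by blast
  let ?h = "min d e / 2"
  have "f s < f (s + ?h)" using d e by simp
  moreover have "s + ?h \<in> S" using d e by (intro subsetD[OF e(2)]) (auto simp: dist_real_def)
  then have "f (s + ?h) \<le> f s"
    using anti d(1) e(1) S by (auto simp: monotone_on_def)
  ultimately show False by simp
qed

text \<open>Concavity of the square root, with the slope 1/(2a) at a^2 replaced by the uniform
  1/(2\<sigma>). It makes the contribution of -s v' to sqrt R linear, so that it can be integrated
  exactly.\<close>

lemma sqrt_add_le: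
  fixes a z \<sigma> :: real
  assumes "0 < \<sigma>" "\<sigma> \<le> a" "0 \<le> z"
  shows "sqrt (a\<^sup>2 + z) \<le> a + z / (2 * \<sigma>)"
proof (rule real_le_lsqrt)
  have "z * 1 \<le> z * (a / \<sigma>)" using assms by (intro mult_left_mono) auto
  moreover have "(a + z / (2 * \<sigma>))\<^sup>2 = a\<^sup>2 + z * (a / \<sigma>) + (z / (2 * \<sigma>))\<^sup>2"
    by (simp add: power2_sum)
  ultimately show "a\<^sup>2 + z \<le> (a + z / (2 * \<sigma>))\<^sup>2"
    using zero_le_power2[of "z / (2 * \<sigma>)"] by linarith
qed (use assms in auto)

section \<open>The weight and the quantities entering the exponent\<close>

locale weight =
  fixes n k :: nat and w :: "real \<Rightarrow> real" and \<Gamma> \<gamma> :: real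
  assumes k: "1 \<le> k" "k \<le> n"
    and w_pos: "\<And>r. r > 0 \<Longrightarrow> w r > 0"
    and w_D: "\<And>r. r > 0 \<Longrightarrow> (w has_real_derivative deriv w r) (at r)"
    and W_D: "\<And>r. r > 0 \<Longrightarrow> (log_slope w has_real_derivative deriv (log_slope w) r) (at r)"
    and W'_cont: "continuous_on {0<..} (deriv (log_slope w))"
    and W_antimono: "antimono_on {0<..} (log_slope w)"
    and W_0: "(log_slope w \<longlongrightarrow> \<Gamma>) (at_right 0)"
    and W_infinity: "(log_slope w \<longlongrightarrow> \<gamma>) at_top"
    and dim: "real n > real k * (real k + 1) / (2 * real k + \<gamma>)"
    and radicand_ge_0: "\<And>s. s \<ge> 1 \<Longrightarrow> radicand n k w s \<ge> 0"
begin

abbreviation v :: "real \<Rightarrow> real" where "v \<equiv> v_fun k w"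
abbreviation v' :: "real \<Rightarrow> real" where "v' \<equiv> deriv (v_fun k w)"
abbreviation R :: "real \<Rightarrow> real" where "R \<equiv> radicand n k w"

text \<open>The limits of \<open>v\<close> at infinity and at 0. As \<open>v\<close> is
  nonincreasing, \<open>q0 - q\<close> is its total variation.\<close>

definition q :: real where "q = (real k - 1 + \<gamma>) / (real k + 1)"
definition q0 :: real where "q0 = (real k - 1 + \<Gamma>) / (real k + 1)"
text \<open>R = X(v) - s v'. Along \<open>v\<close> this polynomial part converges at infinity,
  whereas s v' need not.\<close>

definition X :: "real \<Rightarrow> real" where "X t = t\<^sup>2 + real n / real k * t + real n / real k - 1"
definition y :: "real \<Rightarrow> real" where "y s = v s + sqrt (R s)"
definition E :: "real \<Rightarrow> real" where "E r = integral {1..r} (\<lambda>s. y s / s)"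
text \<open>This is \<delta>(r) ln r with the division by ln r in \<alpha> cleared, so that exp (h
  r) stands for r^\<delta>(r) and r = 1 is no special case.\<close>

definition h :: "real \<Rightarrow> real"
  where "h r = ((- real n + 2 * real k + 2) * ln r + 2 * E r) / (real k + 1)"

lemma k_pos: "real k > 0"
  using k by simp

lemma
  assumes that: "r > 0"
  shows v_D: "(v has_real_derivative v' r) (at r)"
    and v'_eq: "v' r = deriv (log_slope w) r / (real k + 1)"
proof -
  have *: "(v has_real_derivative deriv (log_slope w) r / (real k + 1)) (at r)"
    unfolding v_fun_def[abs_def] by (auto intro!: derivative_eq_intros W_D that)
  then show "v' r = deriv (log_slope w) r / (real k + 1)" by (rule DERIV_imp_deriv)
  with * show "(v has_real_derivative v' r) (at r)" by simp
qed

lemma v'_cont: "continuous_on {0<..} v'"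
  by (rule continuous_on_eq[of _ "\<lambda>r. deriv (log_slope w) r / (real k + 1)"])
     (auto intro!: continuous_intros W'_cont simp: v'_eq)

lemma v_cont: "continuous_on {0<..} v"
  by (intro DERIV_continuous_on) (auto intro: has_field_derivative_at_within v_D)

lemma v_antimono: "antimono_on {0<..} v"
  using W_antimono by (auto simp: monotone_on_def v_fun_def intro!: divide_right_mono)

lemma v'_nonpos: "v' r \<le> 0" if "r > 0"
  using DERIV_antimono_nonpos[OF v_antimono _ _ v_D[OF that]] that by simp

lemma v_tendsto: "(v \<longlongrightarrow> q) at_top"
  unfolding v_fun_def[abs_def] q_def by (intro tendsto_intros W_infinity) simp

lemma v_tendsto_0: "(v \<longlongrightarrow> q0) (at_right 0)"
  unfolding v_fun_def[abs_def] q0_def by (intro tendsto_intros W_0) simp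

lemma v_ge: "q \<le> v r" if "r > 0"
proof (rule tendsto_upperbound[OF v_tendsto])
  show "\<forall>\<^sub>F s in at_top. v s \<le> v r"
    using eventually_ge_at_top[of r]
    by eventually_elim (use v_antimono that in \<open>auto simp: monotone_on_def\<close>)
qed simp

lemma v_le: "v r \<le> q0" if "r > 0"
proof (rule tendsto_lowerbound[OF v_tendsto_0])
  show "\<forall>\<^sub>F s in at_right 0. v r \<le> v s"
    unfolding eventually_at_right_field using that v_antimono
    by (intro exI[of _ r]) (auto simp: monotone_on_def)
qed simp

lemma log_slope_eq: "log_slope w r = (real k + 1) * v r - (real k - 1)"
  by (simp add: v_fun_def field_simps)

lemma R_eq: "R s = X (v s) - s * v' s"
  by (simp add: radicand_def X_def)

lemma R_cont: "continuous_on {0<..} R"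
  unfolding radicand_def[abs_def] by (intro continuous_intros v_cont v'_cont)

lemma y_cont: "continuous_on {0<..} y"
  unfolding y_def[abs_def] by (intro continuous_intros v_cont R_cont)

lemma y_integrable: "0 < a \<Longrightarrow> (\<lambda>s. y s / s) integrable_on {a..b}"
  by (intro integrable_continuous_interval continuous_intros continuous_on_subset[OF y_cont]) auto

lemma E_diff: "E b - E a = integral {a..b} (\<lambda>s. y s / s)" if "1 \<le> a" "a \<le> b"
  unfolding E_def using Henstock_Kurzweil_Integration.integral_combine[OF that y_integrable] by simp

lemma r_powr_delta: "r powr delta n k w r = exp (h r)" if "r > 1"
proof -
  have "alpha n k w r * ln r = E r"
    using that by (simp add: alpha_def alpha_avg_def E_def y_def)
  then have "delta n k w r * ln r = h r"
    by (simp add: delta_def h_def field_simps)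
  then show ?thesis using that by (simp add: powr_def)
qed

text \<open>Divided by s, the term s v'(s) becomes the exact derivative v', whose integral is
  bounded by the total variation of \<open>v\<close> however long the interval is.\<close>

lemma integral_div_le:
  assumes ab: "0 < a" "a \<le> b" and f: "continuous_on {a..b} f"
    and le: "\<And>s. s \<in> {a..b} \<Longrightarrow> f s \<le> C - D * (s * v' s)" and D: "0 \<le> D"
  shows "integral {a..b} (\<lambda>s. f s / s) \<le> C * ln (b / a) + D * (q0 - q)"
proof -
  have "((\<lambda>s. C * ln s - D * v s) has_real_derivative C / s - D * v' s) (at s)" if "s > 0" for s
    using that by (auto intro!: derivative_eq_intros v_D)
  then have I: "((\<lambda>s. C / s - D * v' s) has_integral (C * ln b - D * v b) - (C * ln a - D * v a)) {a..b}"
    using ab(1)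
    by (intro fundamental_theorem_of_calculus ab(2))
       (simp add: has_field_derivative_at_within flip: has_real_derivative_iff_has_vector_derivative)
  have "integral {a..b} (\<lambda>s. f s / s) \<le> integral {a..b} (\<lambda>s. C / s - D * v' s)"
  proof (rule integral_le)
    show "(\<lambda>s. f s / s) integrable_on {a..b}"
      using ab(1) by (intro integrable_continuous_interval continuous_intros f) auto
    fix s assume s: "s \<in> {a..b}"
    then have "f s / s \<le> (C - D * (s * v' s)) / s"
      using le ab by (intro divide_right_mono) auto
    then show "f s / s \<le> C / s - D * v' s" using s ab by (simp add: diff_divide_distrib)
  qed (use I in blast)
  also have "\<dots> = C * (ln b - ln a) + D * (v a - v b)"
    using integral_unique[OF I] by (simp add: algebra_simps)
  also have "\<dots> \<le> C * (ln b - ln a) + D * (q0 - q)"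
    using v_le[of a] v_ge[of b] ab D by (intro add_left_mono mult_left_mono) auto
  finally show ?thesis using ab by (simp add: ln_div)
qed

text \<open>The variation of \<open>v\<close> and the initial segment up to r1 go into the constant
  B; the slope of \<open>h\<close> in ln r depends on C alone.\<close>

lemma h_le:
  assumes r1: "1 \<le> r1" and y: "\<And>s. s \<ge> r1 \<Longrightarrow> y s \<le> C - D * (s * v' s)" and D: "0 \<le> D"
  obtains B where "\<And>r. r \<ge> r1 \<Longrightarrow> h r \<le> (- real n + 2 * real k + 2 + 2 * C) / (real k + 1) * ln r + B"
proof
  fix r assume r: "r \<ge> r1"
  have "E r - E r1 \<le> C * ln (r / r1) + D * (q0 - q)"
    unfolding E_diff[OF r1 r] using r1 r D y
    by (intro integral_div_le continuous_on_subset[OF y_cont]) auto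
  then have "E r \<le> C * ln r + (E r1 - C * ln r1 + D * (q0 - q))"
    using r1 r by (simp add: ln_div algebra_simps)
  then have "h r \<le> ((- real n + 2 * real k + 2) * ln r + 2 * (C * ln r + (E r1 - C * ln r1 + D * (q0 - q)))) / (real k + 1)"
    unfolding h_def by (intro divide_right_mono add_left_mono) auto
  then show "h r \<le> (- real n + 2 * real k + 2 + 2 * C) / (real k + 1) * ln r
      + 2 * (E r1 - C * ln r1 + D * (q0 - q)) / (real k + 1)"
    by (simp add: add_divide_distrib[symmetric] algebra_simps)
qed

lemma X_v_tendsto: "((\<lambda>s. X (v s)) \<longlongrightarrow> X q) at_top"
  unfolding X_def by (intro tendsto_intros v_tendsto)

text \<open>The roots are -1 and 1 - n/k. By \<open>q_plus_1\<close> the value q = -1 corresponds to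
  2k + \<gamma> = 0, which separates the two regimes.\<close>

lemma X_factor: "X t = (t + 1) * (t - 1 + real n / real k)"
  by (simp add: X_def power2_eq_square algebra_simps add_divide_distrib)

lemma q_plus_1: "q + 1 = (2 * real k + \<gamma>) / (real k + 1)"
  by (simp add: q_def field_simps)

end

section \<open>Weights with 2k + \<gamma> < 0\<close>

locale subcritical_weight = weight +
  assumes subcritical: "2 * real k + \<gamma> < 0"
begin

(* Otherwise X q < 0, and nonnegativity of the radicand would force - s v'(s) to be bounded
   below by a positive constant, contradicting the boundedness of v. *)
lemma q_less: "q + real n / (2 * real k) < 0"
proof (rule ccontr)
  assume "\<not> ?thesis"
  then have nk: "real n / real k \<ge> - 2 * q" using k_pos by (simp add: field_simps)
  have q1: "q + 1 < 0" unfolding q_plus_1 using subcritical by (simp add: divide_neg_pos)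
  \<comment> \<open>The two factors have opposite signs: n/k \<ge> -2q gives q - 1 + n/k \<ge> -(q +
    1) > 0.\<close>
  then have "X q < 0"
    unfolding X_factor using nk by (intro mult_neg_pos) auto
  then have "\<forall>\<^sub>F s in at_top. X (v s) < X q / 2"
    by (intro order_tendstoD(2)[OF X_v_tendsto]) simp
  then obtain a where a: "\<And>s. s \<ge> a \<Longrightarrow> X (v s) < X q / 2"
    by (auto simp: eventually_at_top_linorder)
  define a' where "a' = max a 1"
  define c where "c = - X q / 2"
  have c: "c > 0" using \<open>X q < 0\<close> by (simp add: c_def)
  \<comment> \<open>Chosen so that c ln (b / a') = |q0 - q| + 1 exceeds the total variation of
    \<open>v\<close>; integrating the nonnegativity of R over [a', b] is then impossible.\<close>
  define b where "b = a' * exp ((\<bar>q0 - q\<bar> + 1) / c)"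
  have "1 \<le> exp ((\<bar>q0 - q\<bar> + 1) / c)" using c by simp
  moreover have a': "0 < a'" by (simp add: a'_def)
  ultimately have ab: "0 < a'" "a' \<le> b" unfolding b_def by simp_all
  have "integral {a'..b} (\<lambda>s. 0 / s) \<le> - c * ln (b / a') + 1 * (q0 - q)"
  proof (rule integral_div_le[OF ab])
    fix s assume "s \<in> {a'..b}"
    then have "s \<ge> 1" "s \<ge> a" by (auto simp: a'_def)
    with a[of s] radicand_ge_0[of s] show "0 \<le> - c - 1 * (s * v' s)"
      unfolding R_eq c_def by simp
  qed auto
  moreover have "ln (b / a') = (\<bar>q0 - q\<bar> + 1) / c" using ab by (simp add: b_def)
  ultimately show False using c by simp
qed

text \<open>With m = n/(2k), completing the square gives X(t) = (t + m)^2 - (m - 1)^2. As v + m is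
  eventually negative, sqrt R is at most -(v + m) plus an integrable error, so v cancels in
  \<open>y\<close> and -m remains.\<close>

lemma h_le_subcritical:
  obtains r1 B where "1 \<le> r1" "\<And>r. r \<ge> r1 \<Longrightarrow> h r \<le> (2 - real n / real k) * ln r + B"
proof -
  define m where "m = real n / (2 * real k)"
  define \<sigma> where "\<sigma> = - (q + m) / 2"
  have \<sigma>: "\<sigma> > 0" using q_less by (simp add: \<sigma>_def m_def)
  have "\<forall>\<^sub>F s in at_top. v s < q + \<sigma>"
    using \<sigma> by (intro order_tendstoD(2)[OF v_tendsto]) simp
  then obtain a where a: "\<And>s. s \<ge> a \<Longrightarrow> v s < q + \<sigma>"
    by (auto simp: eventually_at_top_linorder)
  define r1 where "r1 = max a 1"
  have "y s \<le> - m - 1 / (2 * \<sigma>) * (s * v' s)" if s: "s \<ge> r1" for s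
  proof -
    have s': "s \<ge> a" "s > 0" using s by (auto simp: r1_def)
    have "v s + m \<le> - \<sigma>" using a[OF s'(1)] by (simp add: \<sigma>_def field_simps)
    then have A: "\<sigma> \<le> - (v s + m)" by simp
    have z: "0 \<le> - (s * v' s)"
      using v'_nonpos[OF s'(2)] s'(2) by (simp add: mult_nonneg_nonpos)
    have nk: "real n / real k = 2 * m" by (simp add: m_def)
    have "R s = (- (v s + m))\<^sup>2 + - (s * v' s) - (m - 1)\<^sup>2"
      unfolding R_eq X_def nk by (simp add: power2_eq_square algebra_simps)
    then have "sqrt (R s) \<le> sqrt ((- (v s + m))\<^sup>2 + - (s * v' s))"
      by simp
    also have "\<dots> \<le> - (v s + m) + - (s * v' s) / (2 * \<sigma>)"
      by (rule sqrt_add_le[OF \<sigma> A z])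
    finally show ?thesis unfolding y_def by simp
  qed
  moreover have "1 \<le> r1" by (simp add: r1_def)
  moreover have "0 \<le> 1 / (2 * \<sigma>)" using \<sigma> by simp
  ultimately obtain B where "\<And>r. r \<ge> r1 \<Longrightarrow> h r \<le> (- real n + 2 * real k + 2 + 2 * (- m)) / (real k + 1) * ln r + B"
    using h_le by metis
  moreover have "(- real n + 2 * real k + 2 + 2 * (- m)) / (real k + 1) = 2 - real n / real k"
  proof -
    have "real n = 2 * m * real k" "real n / real k = 2 * m" using k_pos by (simp_all add: m_def)
    then have "- real n + 2 * real k + 2 + 2 * (- m) = (2 - real n / real k) * (real k + 1)"
      by (simp add: algebra_simps)
    then show ?thesis by simp
  qed
  ultimately show thesis using that \<open>1 \<le> r1\<close> by metis
qed

end

section \<open>Weights with 2k + \<gamma> > 0\<close>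

locale supercritical_weight = weight +
  assumes supercritical: "2 * real k + \<gamma> > 0"
begin

text \<open>A uniform lower bound for R - v^2. For 2k + \<gamma> > 0 the hypothesis on the dimension
  says exactly that it is positive.\<close>

definition c1 :: real where "c1 = real n / real k * (q + 1) - 1"
(* \<kappa> is the limit of \<delta>(r) as r tends to infinity. *)
definition \<kappa> :: real where "\<kappa> = (- real n + 2 * real k + 2 + 2 * (q + sqrt (X q))) / (real k + 1)"

lemma c1_pos: "c1 > 0"
proof -
  have "real k * (real k + 1) < real n * (2 * real k + \<gamma>)"
    using dim supercritical by (simp add: pos_divide_less_eq)
  then have "1 < real n * (2 * real k + \<gamma>) / (real k * (real k + 1))"
    using k_pos by (subst less_divide_eq_1_pos) auto
  then show ?thesis unfolding c1_def q_plus_1 by simp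
qed

lemma potential_ge: "c1 \<le> real n / real k * (v s + 1) - 1 - s * v' s" if "s > 0"
proof -
  have "s * v' s \<le> 0" using v'_nonpos[OF that] that by (simp add: mult_nonneg_nonpos)
  moreover have "real n / real k * (q + 1) \<le> real n / real k * (v s + 1)"
    using v_ge[OF that] by (intro mult_left_mono) auto
  ultimately show ?thesis by (simp add: c1_def)
qed

lemma R_eq_potential: "R s = (v s)\<^sup>2 + (real n / real k * (v s + 1) - 1 - s * v' s)"
  by (simp add: radicand_def distrib_left)

lemma R_ge: "R s \<ge> (v s)\<^sup>2 + c1" if "s > 0"
  unfolding R_eq_potential using potential_ge[OF that] by simp

lemma R_pos: "R s > 0" if "s > 0"
  using R_ge[OF that] c1_pos zero_le_power2[of "v s"] by linarith

lemma abs_v_le: "\<bar>v s\<bar> \<le> sqrt (R s)" if "s > 0"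
  using R_ge[OF that] c1_pos by (intro real_le_rsqrt) auto

lemma y_nonneg: "y s \<ge> 0" if "s > 0"
  using abs_v_le[OF that] by (auto simp: y_def)

lemma abs_v_bound: "\<bar>v s\<bar> \<le> \<bar>q\<bar> + \<bar>q0\<bar>" if "s > 0"
  using v_le[OF that] v_ge[OF that] by auto

text \<open>The bound sqrt t \<le> 1 + t is crude, but any bound affine in s v' integrates to a
  constant over dyadic intervals, which is all it serves for.\<close>

lemma sqrt_R_y_le:
  obtains C where "0 \<le> C" "\<And>s. s > 0 \<Longrightarrow> sqrt (R s) \<le> C - s * v' s" "\<And>s. s > 0 \<Longrightarrow> y s \<le> C - s * v' s"
proof -
  define M where "M = \<bar>q\<bar> + \<bar>q0\<bar>"
  define K where "K = M\<^sup>2 + real n / real k * M + real n / real k"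
  have "sqrt (R s) \<le> 1 + K - s * v' s" if "s > 0" for s
  proof -
    have "X (v s) \<le> K - 1"
    proof -
      have "\<bar>v s\<bar> \<le> M" using abs_v_bound[OF that] by (simp add: M_def)
      then have "(v s)\<^sup>2 \<le> M\<^sup>2" "v s \<le> M"
        by (auto simp: abs_le_square_iff[symmetric])
      moreover from this(2) have "real n / real k * v s \<le> real n / real k * M"
        by (rule mult_left_mono) simp
      ultimately show ?thesis unfolding X_def K_def by linarith
    qed
    moreover have "sqrt (R s) \<le> 1 + R s"
      using R_pos[OF that] by (intro real_le_lsqrt) (auto simp: power2_eq_square algebra_simps)
    ultimately show ?thesis unfolding R_eq by linarith
  qed
  moreover have "M \<ge> 0" "K \<ge> 0" by (auto simp: M_def K_def)
  moreover have "v s \<le> M" if "s > 0" for s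
    using abs_v_bound[OF that] by (simp add: M_def)
  ultimately show thesis
    by (intro that[of "1 + K + M"]) (force simp: y_def)+
qed

text \<open>2q + n/k is the derivative of the convex polynomial X at q; its positivity makes X
  increasing on [q, \<infinity>), where \<open>v\<close> takes its values.\<close>

lemma X_q_pos: "X q > 0" and q_pole: "2 * q + real n / real k > 0"
proof -
  have "X q = q\<^sup>2 + c1" by (simp add: X_def c1_def distrib_left)
  then show "X q > 0" using c1_pos zero_le_power2[of q] by linarith
  moreover have q1: "q + 1 > 0" unfolding q_plus_1 using supercritical by simp
  ultimately have "q - 1 + real n / real k > 0"
    unfolding X_factor by (simp add: zero_less_mult_iff)
  then show "2 * q + real n / real k > 0" using q1 by linarith
qed

lemma X_v_ge: "X (v s) \<ge> X q" if "s > 0"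
proof -
  have "X (v s) - X q = (v s - q) * (v s + q + real n / real k)"
    by (simp add: X_def power2_eq_square algebra_simps)
  moreover have "\<dots> \<ge> 0" using v_ge[OF that] q_pole by (intro mult_nonneg_nonneg) linarith+
  ultimately show ?thesis by linarith
qed

lemma y_ge: "q + sqrt (X q) \<le> y s" if "s > 0"
proof -
  have "X q \<le> R s" unfolding R_eq using X_v_ge[OF that] v'_nonpos[OF that] that
    by (smt (verit) mult_nonneg_nonpos)
  then show ?thesis unfolding y_def using v_ge[OF that] by (intro add_mono) auto
qed

text \<open>Since v and X(v) stay above their limits and -s v' \<ge> 0, the averaged exponent never
  falls below its limit \<kappa>. For \<kappa> = 0 this leaves exp (h r) \<ge> 1.\<close>

lemma h_ge: "\<kappa> * ln r \<le> h r" if "r \<ge> 1"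
proof -
  have I: "((\<lambda>s. (q + sqrt (X q)) / s) has_integral (q + sqrt (X q)) * ln r - (q + sqrt (X q)) * ln 1) {1..r}"
    using that
    by (intro fundamental_theorem_of_calculus)
       (auto intro!: derivative_eq_intros simp flip: has_real_derivative_iff_has_vector_derivative)
  have "(q + sqrt (X q)) * ln r \<le> E r"
    using I y_ge unfolding E_def
    by (intro has_integral_le[OF _ integrable_integral[OF y_integrable]]) (auto intro!: divide_right_mono)
  then have "((- real n + 2 * real k + 2) * ln r + 2 * ((q + sqrt (X q)) * ln r)) / (real k + 1) \<le> h r"
    unfolding h_def by (intro divide_right_mono add_left_mono) auto
  then show ?thesis by (simp add: \<kappa>_def algebra_simps)
qed

lemma h_at_top: "filterlim h at_top at_top" if "\<kappa> > 0"
proof (rule filterlim_at_top_mono)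
  show "filterlim (\<lambda>r. \<kappa> * ln r) at_top at_top"
    by (intro filterlim_tendsto_pos_mult_at_top[OF tendsto_const that] ln_at_top)
  show "\<forall>\<^sub>F r in at_top. \<kappa> * ln r \<le> h r"
    using eventually_ge_at_top[of 1] by eventually_elim (rule h_ge)
qed

lemma h_at_bot: "filterlim h at_bot at_top" if "\<kappa> < 0"
proof -
  \<comment> \<open>With this choice 2\<epsilon>/(k+1) = -\<kappa>/2, so the slope \<kappa> is
    worsened only to \<kappa>/2 and remains negative.\<close>
  define \<epsilon> where "\<epsilon> = - \<kappa> * (real k + 1) / 4"
  have \<epsilon>: "\<epsilon> > 0" using that by (simp add: \<epsilon>_def mult_neg_pos)
  have "((\<lambda>s. v s + sqrt (X (v s))) \<longlongrightarrow> q + sqrt (X q)) at_top"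
    by (intro tendsto_intros v_tendsto X_v_tendsto)
  then have "\<forall>\<^sub>F s in at_top. v s + sqrt (X (v s)) < q + sqrt (X q) + \<epsilon>"
    using \<epsilon> by (intro order_tendstoD(2)) auto
  then obtain a where a: "\<And>s. s \<ge> a \<Longrightarrow> v s + sqrt (X (v s)) < q + sqrt (X q) + \<epsilon>"
    by (auto simp: eventually_at_top_linorder)
  define r1 where "r1 = max a 1"
  define D where "D = 1 / (2 * sqrt (X q))"
  have "y s \<le> (q + sqrt (X q) + \<epsilon>) - D * (s * v' s)" if s: "s \<ge> r1" for s
  proof -
    have s': "s \<ge> a" "s > 0" using s by (auto simp: r1_def)
    have z: "0 \<le> - (s * v' s)"
      using v'_nonpos[OF s'(2)] s'(2) by (simp add: mult_nonneg_nonpos)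
    have "sqrt (R s) = sqrt ((sqrt (X (v s)))\<^sup>2 + - (s * v' s))"
      unfolding R_eq using X_v_ge[OF s'(2)] X_q_pos by simp
    also have "\<dots> \<le> sqrt (X (v s)) + - (s * v' s) / (2 * sqrt (X q))"
      using X_v_ge[OF s'(2)] X_q_pos z by (intro sqrt_add_le) auto
    finally show ?thesis using a[OF s'(1)] unfolding y_def D_def by simp
  qed
  moreover have "1 \<le> r1" by (simp add: r1_def)
  moreover have "0 \<le> D" using X_q_pos by (simp add: D_def)
  ultimately obtain B where B: "\<And>r. r \<ge> r1 \<Longrightarrow>
      h r \<le> (- real n + 2 * real k + 2 + 2 * (q + sqrt (X q) + \<epsilon>)) / (real k + 1) * ln r + B"
    using h_le by metis
  have "(- real n + 2 * real k + 2 + 2 * (q + sqrt (X q) + \<epsilon>)) / (real k + 1) = \<kappa> / 2"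
  proof -
    have "\<kappa> * (real k + 1) = - real n + 2 * real k + 2 + 2 * (q + sqrt (X q))"
      by (simp add: \<kappa>_def)
    then have "- real n + 2 * real k + 2 + 2 * (q + sqrt (X q) + \<epsilon>) = \<kappa> / 2 * (real k + 1)"
      unfolding \<epsilon>_def by argo
    then show ?thesis by simp
  qed
  note B' = B[unfolded this]
  show ?thesis
  proof (rule filterlim_at_bot_mono)
    have "filterlim (\<lambda>r. \<kappa> / 2 * ln r) at_bot at_top"
      using that by (intro filterlim_tendsto_neg_mult_at_bot[OF tendsto_const _ ln_at_top]) auto
    then have "filterlim (\<lambda>r. - B + - (\<kappa> / 2 * ln r)) at_top at_top"
      by (intro filterlim_tendsto_add_at_top[OF tendsto_const]) (simp add: filterlim_uminus_at_bot)
    then show "filterlim (\<lambda>r. B + \<kappa> / 2 * ln r) at_bot at_top"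
      by (simp add: filterlim_uminus_at_bot)
    show "\<forall>\<^sub>F r in at_top. h r \<le> B + \<kappa> / 2 * ln r"
      using eventually_ge_at_top[of r1] by eventually_elim (use B' in \<open>simp add: add.commute\<close>)
  qed
qed

text \<open>\<kappa> = 0 means sqrt (X q) = a - q. Squaring introduces the spurious solution N = 2K,
  where a = -1 < q contradicts a - q \<ge> 0. At the genuine solution K (a - q) = (q + 1)(K + 2) >
  0.\<close>

lemma \<kappa>_eq_0_iff: "\<kappa> = 0 \<longleftrightarrow> real n = 2 * (real k + 2 * \<gamma> / real k + 4)"
proof -
  define N where "N = real n"
  define K where "K = real k"
  define a where "a = (N - 2 * K - 2) / 2"
  have K: "K > 0" using k_pos by (simp add: K_def)
  have qK: "\<gamma> = q * (K + 1) - (K - 1)" unfolding q_def K_def by (simp add: field_simps)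
  have "\<kappa> = 0 \<longleftrightarrow> sqrt (X q) = a - q"
    unfolding \<kappa>_def a_def N_def K_def by (auto simp: field_simps)
  also have "\<dots> \<longleftrightarrow> (a - q \<ge> 0 \<and> X q = (a - q)\<^sup>2)"
  proof
    assume eq: "sqrt (X q) = a - q"
    have "X q = (sqrt (X q))\<^sup>2" "0 \<le> sqrt (X q)" using X_q_pos by simp_all
    then show "a - q \<ge> 0 \<and> X q = (a - q)\<^sup>2" unfolding eq by simp
  qed simp
  also have "X q = (a - q)\<^sup>2 \<longleftrightarrow> (N - 2 * K) * (N - 2 * (K + 2 * \<gamma> / K + 4)) = 0"
  proof -
    define m where "m = N / K"
    have N: "N = K * m" using K by (simp add: m_def)
    have "(N - 2 * K) * (N - 2 * (K + 2 * \<gamma> / K + 4)) =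
        (K * (m - 2))\<^sup>2 - 8 * (K * (m - 2)) - 4 * (m - 2) * (K * (\<gamma> / K))"
      unfolding N by (simp add: power2_eq_square algebra_simps)
    also have "K * (\<gamma> / K) = q * (K + 1) - (K - 1)" using K qK by simp
    also have "(K * (m - 2))\<^sup>2 - 8 * (K * (m - 2)) - 4 * (m - 2) * (q * (K + 1) - (K - 1)) =
        4 * ((a - q)\<^sup>2 - (q\<^sup>2 + m * q + m - 1))"
      unfolding a_def N by (simp add: power2_eq_square field_simps)
    also have "q\<^sup>2 + m * q + m - 1 = X q" by (simp add: X_def m_def N_def K_def)
    finally show ?thesis by auto
  qed
  also have "(a - q \<ge> 0 \<and> (N - 2 * K) * (N - 2 * (K + 2 * \<gamma> / K + 4)) = 0) \<longleftrightarrow>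
      N = 2 * (K + 2 * \<gamma> / K + 4)"
  proof
    assume "a - q \<ge> 0 \<and> (N - 2 * K) * (N - 2 * (K + 2 * \<gamma> / K + 4)) = 0"
    then have "a - q \<ge> 0" "N - 2 * K = 0 \<or> N - 2 * (K + 2 * \<gamma> / K + 4) = 0" by simp_all
    moreover have "q > -1" using q_plus_1 supercritical by (smt (verit) divide_pos_pos of_nat_0_le_iff)
    then have "N = 2 * K \<Longrightarrow> a - q < 0" by (simp add: a_def)
    ultimately show "N = 2 * (K + 2 * \<gamma> / K + 4)" by linarith
  next
    assume N: "N = 2 * (K + 2 * \<gamma> / K + 4)"
    have "K * (\<gamma> / K) = q * (K + 1) - (K - 1)" using K qK by simp
    moreover have "a = 3 + 2 * (\<gamma> / K)" using N by (simp add: a_def)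
    then have "K * (a - q) = 3 * K + 2 * (K * (\<gamma> / K)) - K * q" by (simp only: algebra_simps)
    ultimately have "K * (a - q) = (q + 1) * (K + 2)" by (simp only:) (simp add: algebra_simps)
    moreover have "(q + 1) * (K + 2) > 0"
      unfolding q_plus_1 using K supercritical by (intro mult_pos_pos divide_pos_pos) auto
    ultimately have "K * (a - q) > 0" by simp
    then have "a - q > 0" using K by (rule zero_less_mult_pos)
    then show "a - q \<ge> 0 \<and> (N - 2 * K) * (N - 2 * (K + 2 * \<gamma> / K + 4)) = 0" using N by simp
  qed
  finally show ?thesis by (simp add: N_def K_def)
qed

text \<open>\<open>E\<close> is nondecreasing and its increment over a dyadic interval is bounded by
  \<open>integral_div_le\<close>, so r^\<delta>(r) changes there by at most a fixed factor.\<close>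

lemma h_oscillation:
  obtains D where "\<And>a s t. 1 \<le> a \<Longrightarrow> s \<in> {a..2*a} \<Longrightarrow> t \<in> {a..2*a} \<Longrightarrow> \<bar>h s - h t\<bar> \<le> D"
proof -
  obtain C where C: "0 \<le> C" "\<And>s. s > 0 \<Longrightarrow> y s \<le> C - s * v' s"
    using sqrt_R_y_le by metis
  define A where "A = \<bar>- real n + 2 * real k + 2\<bar>"
  define D where "D = (A * ln 2 + 2 * (C * ln 2 + (q0 - q))) / (real k + 1)"
  have ordered: "\<bar>h t - h s\<bar> \<le> D" if "1 \<le> a" "s \<in> {a..2*a}" "t \<in> {a..2*a}" "s \<le> t" for a s t
  proof -
    have s: "1 \<le> s" "0 < s" "t / s \<le> 2" "1 \<le> t / s" using that by (auto simp: field_simps)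
    have ln: "0 \<le> ln (t / s)" "ln (t / s) \<le> ln 2" using s by auto
    have "integral {s..t} (\<lambda>s. y s / s) \<le> C * ln (t / s) + 1 * (q0 - q)"
      using that s C by (intro integral_div_le continuous_on_subset[OF y_cont]) auto
    also have "C * ln (t / s) \<le> C * ln 2" by (intro mult_left_mono ln C)
    finally have up: "E t - E s \<le> C * ln 2 + (q0 - q)"
      unfolding E_diff[OF s(1) that(4)] by simp
    have lo: "0 \<le> E t - E s"
      unfolding E_diff[OF s(1) that(4)] using s y_nonneg
      by (intro integral_nonneg y_integrable) auto
    have "h t - h s = ((- real n + 2 * real k + 2) * ln (t / s) + 2 * (E t - E s)) / (real k + 1)"
      using s that unfolding h_def by (simp add: ln_div diff_divide_distrib[symmetric] algebra_simps)
    then have "\<bar>h t - h s\<bar> = \<bar>(- real n + 2 * real k + 2) * ln (t / s) + 2 * (E t - E s)\<bar> / (real k + 1)"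
      by simp
    also have "\<dots> \<le> D" unfolding D_def
    proof (intro divide_right_mono)
      have "\<bar>(- real n + 2 * real k + 2) * ln (t / s)\<bar> = A * ln (t / s)"
        using ln by (simp add: abs_mult A_def)
      also have "\<dots> \<le> A * ln 2" using ln by (intro mult_left_mono) (auto simp: A_def)
      finally have "\<bar>(- real n + 2 * real k + 2) * ln (t / s)\<bar> \<le> A * ln 2" .
      moreover have "\<bar>x + 2 * z\<bar> \<le> a + 2 * b" if "\<bar>x\<bar> \<le> a" "0 \<le> z" "z \<le> b" for x z a b :: real
        using that by linarith
      ultimately show "\<bar>(- real n + 2 * real k + 2) * ln (t / s) + 2 * (E t - E s)\<bar>
          \<le> A * ln 2 + 2 * (C * ln 2 + (q0 - q))" using up lo by blast
    qed simp
    finally show ?thesis .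
  qed
  show thesis
  proof (rule that[of D])
    fix a s t :: real assume "1 \<le> a" "s \<in> {a..2*a}" "t \<in> {a..2*a}"
    then show "\<bar>h s - h t\<bar> \<le> D" using ordered[of a s t] ordered[of a t s]
      by (cases "s \<le> t") (auto simp: abs_minus_commute)
  qed
qed

end

section \<open>Integrating a lower bound on the derivative\<close>

text \<open>In the mean value theorem the length a compensates the factor 1/r of the lower bound.
  The oscillation bound then moves l to any point s: s = 2a when U grows, s = a when U(2r) - U(r) is
  measured from its left end.\<close>

lemma dyadic_increment_ge:
  fixes U p l :: "real \<Rightarrow> real"
  assumes U: "\<And>t. (U has_real_derivative p t) (at t)"
    and lower: "\<And>r. r \<ge> r0 \<Longrightarrow> c * exp (l r) / r \<le> p r" and c: "c > 0" and r0: "r0 \<ge> 1"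
    and osc: "\<And>a s t. r0 \<le> a \<Longrightarrow> s \<in> {a..2*a} \<Longrightarrow> t \<in> {a..2*a} \<Longrightarrow> \<bar>l s - l t\<bar> \<le> D"
    and a: "a \<ge> r0" and s: "s \<in> {a..2*a}"
  shows "c * exp (- D) / 2 * exp (l s) \<le> U (2 * a) - U a"
proof -
  have a1: "a \<ge> 1" using a r0 by simp
  then obtain z where z: "a < z" "z < 2 * a" "U (2 * a) - U a = (2 * a - a) * p z"
    using MVT2[of a "2 * a" U p] U by auto
  have "l s - D \<le> l z" using osc[OF a s, of z] z by auto
  then have "c * exp (l s - D) \<le> c * exp (l z)" using c by simp
  then have "c * exp (l s - D) / (2 * a) \<le> c * exp (l z) / z"
    using z a1 c by (intro frac_le) auto
  also have "\<dots> \<le> p z" using lower z a by simp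
  finally have "a * (c * exp (l s - D) / (2 * a)) \<le> a * p z"
    using a1 by (intro mult_left_mono) auto
  moreover have "a * (c * exp (l s - D) / (2 * a)) = c * exp (- D) / 2 * exp (l s)"
    using a1 by (simp add: exp_diff exp_minus inverse_eq_divide)
  moreover have "U (2 * a) - U a = a * p z" using z by simp
  ultimately show ?thesis by simp
qed

text \<open>U may be negative at r0. Taking half of the dyadic constant leaves room to absorb this
  fixed value, since exp (l r) tends to infinity.\<close>

lemma abs_ge_of_derivative_at_top:
  fixes U p l :: "real \<Rightarrow> real"
  assumes U: "\<And>t. (U has_real_derivative p t) (at t)" and p: "\<And>t. t \<ge> 0 \<Longrightarrow> p t \<ge> 0"
    and lower: "\<And>r. r \<ge> r0 \<Longrightarrow> c * exp (l r) / r \<le> p r" and c: "c > 0" and r0: "r0 \<ge> 1"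
    and osc: "\<And>a s t. r0 \<le> a \<Longrightarrow> s \<in> {a..2*a} \<Longrightarrow> t \<in> {a..2*a} \<Longrightarrow> \<bar>l s - l t\<bar> \<le> D"
    and l: "filterlim l at_top at_top"
  obtains M r1 where "M > 0" "r1 \<ge> 1" "\<And>r. r \<ge> r1 \<Longrightarrow> M * exp (l r) \<le> \<bar>U r\<bar>"
proof -
  have dyadic: "c * exp (- D) / 2 * exp (l s) \<le> U (2 * a) - U a" if "a \<ge> r0" "s \<in> {a..2*a}" for a s
    by (rule dyadic_increment_ge[OF U lower c r0 _ that]) (use osc in auto)
  define M where "M = c * exp (- D) / 4"
  have M: "M > 0" using c by (simp add: M_def)
  have mono: "U s \<le> U t" if "0 \<le> s" "s \<le> t" for s t
  proof (rule DERIV_nonneg_imp_nondecreasing[OF that(2), where f = U])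
    fix x assume "s \<le> x"
    then show "\<exists>y. (U has_real_derivative y) (at x) \<and> 0 \<le> y"
      using U[of x] p[of x] that by auto
  qed
  have "filterlim (\<lambda>r. exp (l r)) at_top at_top"
    by (rule filterlim_compose[OF exp_at_top l])
  then have "\<forall>\<^sub>F r in at_top. exp (l r) \<ge> - U r0 / M"
    by (simp add: filterlim_at_top)
  then obtain a where a: "\<And>r. r \<ge> a \<Longrightarrow> exp (l r) \<ge> - U r0 / M"
    by (auto simp: eventually_at_top_linorder)
  show thesis
  proof (rule that[of M "max a (2 * r0)"])
    fix r assume r: "r \<ge> max a (2 * r0)"
    have "2 * M * exp (l r) \<le> U (2 * (r / 2)) - U (r / 2)"
      using dyadic[of "r / 2" r] r r0 by (simp add: M_def)
    moreover have "U r0 \<le> U (r / 2)" using r r0 by (intro mono) auto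
    moreover have "- U r0 \<le> M * exp (l r)" using a[of r] r M by (simp add: pos_divide_le_eq mult.commute del: minus_divide_left divide_minus_left)
    ultimately show "M * exp (l r) \<le> \<bar>U r\<bar>" by simp
  qed (use M r0 in auto)
qed

lemma abs_ge_of_derivative_at_bot:
  fixes U p l :: "real \<Rightarrow> real"
  assumes U: "\<And>t. (U has_real_derivative p t) (at t)" and p: "\<And>t. t \<ge> 0 \<Longrightarrow> p t \<ge> 0"
    and lower: "\<And>r. r \<ge> r0 \<Longrightarrow> c * exp (l r) / r \<le> p r" and c: "c > 0" and r0: "r0 \<ge> 1"
    and osc: "\<And>a s t. r0 \<le> a \<Longrightarrow> s \<in> {a..2*a} \<Longrightarrow> t \<in> {a..2*a} \<Longrightarrow> \<bar>l s - l t\<bar> \<le> D"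
    and l: "filterlim l at_bot at_top"
  obtains M r1 where "M > 0" "r1 \<ge> 1" "\<And>r. r \<ge> r1 \<Longrightarrow> M * exp (l r) \<le> \<bar>U r\<bar>"
  (* If U is positive somewhere, it stays above a positive constant; otherwise
     |U r| \<ge> U (2r) - U r. *)
proof (cases "\<exists>r2\<ge>r0. U r2 > 0")
  case True
  then obtain r2 where r2: "r2 \<ge> r0" "U r2 > 0" by auto
  have "\<forall>\<^sub>F r in at_top. l r \<le> 0"
    using l by (simp add: filterlim_at_bot)
  then obtain a where a: "\<And>r. r \<ge> a \<Longrightarrow> l r \<le> 0"
    by (auto simp: eventually_at_top_linorder)
  show thesis
  proof (rule that[of "U r2" "max a r2"])
    fix r assume r: "r \<ge> max a r2"
    have "U r2 \<le> U r"
    proof (rule DERIV_nonneg_imp_nondecreasing[where f = U])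
      fix x assume "r2 \<le> x"
      then show "\<exists>y. (U has_real_derivative y) (at x) \<and> 0 \<le> y"
        using U[of x] p[of x] r2 r0 by auto
    qed (use r in auto)
    moreover have "U r2 * exp (l r) \<le> U r2 * 1"
      using a[of r] r r2 by (intro mult_left_mono) auto
    ultimately show "U r2 * exp (l r) \<le> \<bar>U r\<bar>" by simp
  qed (use r2 r0 in auto)
next
  case False
  have dyadic: "c * exp (- D) / 2 * exp (l s) \<le> U (2 * a) - U a" if "a \<ge> r0" "s \<in> {a..2*a}" for a s
    by (rule dyadic_increment_ge[OF U lower c r0 _ that]) (use osc in auto)
  show thesis
  proof (rule that[of "c * exp (- D) / 2" r0])
    fix r assume r: "r \<ge> r0"
    then have "U (2 * r) \<le> 0" using False r0 by (auto simp: not_less)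
    then show "c * exp (- D) / 2 * exp (l r) \<le> \<bar>U r\<bar>"
      using dyadic[of r r] r r0 by auto
  qed (use c r0 in auto)
qed

lemma abs_ge_ln_of_derivative:
  fixes U p :: "real \<Rightarrow> real"
  assumes U: "\<And>t. (U has_real_derivative p t) (at t)"
    and lower: "\<And>r. r \<ge> r0 \<Longrightarrow> c / r \<le> p r" and c: "c > 0" and r0: "r0 \<ge> 1"
  obtains r1 where "r1 \<ge> 1" "\<And>r. r \<ge> r1 \<Longrightarrow> c / 2 * ln r \<le> \<bar>U r\<bar>"
proof -
  have incr: "U r0 - c * ln r0 \<le> U r - c * ln r" if "r \<ge> r0" for r
  proof (rule DERIV_nonneg_imp_nondecreasing[OF that, where f = "\<lambda>r. U r - c * ln r"])
    fix x assume x: "r0 \<le> x"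
    then have "((\<lambda>r. U r - c * ln r) has_real_derivative p x - c / x) (at x)"
      using r0 by (auto intro!: derivative_eq_intros U)
    then show "\<exists>y. ((\<lambda>r. U r - c * ln r) has_real_derivative y) (at x) \<and> 0 \<le> y"
      using lower[OF x] by auto
  qed
  have "\<forall>\<^sub>F r in at_top. ln r \<ge> (c * ln r0 - U r0) * 2 / c"
    using ln_at_top by (simp add: filterlim_at_top)
  then obtain a where a: "\<And>r. r \<ge> a \<Longrightarrow> ln r \<ge> (c * ln r0 - U r0) * 2 / c"
    by (auto simp: eventually_at_top_linorder)
  show thesis
  proof (rule that[of "max a r0"])
    fix r assume r: "r \<ge> max a r0"
    have "c * ln r0 - U r0 \<le> c / 2 * ln r" using a[of r] r c by (simp add: field_simps)
    then show "c / 2 * ln r \<le> \<bar>U r\<bar>" using incr[of r] r by simp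
  qed (use r0 in auto)
qed

section \<open>The second variation along radial solutions\<close>

text \<open>Dividing by r instead of lowering the exponent avoids truncated subtraction at m = 0,
  which occurs for n = k.\<close>

lemma DERIV_power_div: "((\<lambda>r. r ^ m) has_real_derivative real m * r ^ m / r) (at r)" if "r \<noteq> 0" for r :: real
  using that DERIV_pow[of m r] by (cases m) auto

text \<open>The problem in one variable, with c in the role of c_{n,k}. Stability is recorded for
  test functions supported in compact subintervals of (0, \<infinity>), where all weights are
  continuous.\<close>

locale radial_sol = weight +
  fixes g U p p' :: "real \<Rightarrow> real" and c :: real
  assumes c_pos: "c > 0"
    and g_D: "\<And>t. (g has_real_derivative deriv g t) (at t)"
    and g_nonneg: "\<And>t. g t \<ge> 0" and g_antimono: "antimono g"
    and U_D: "\<And>t. (U has_real_derivative p t) (at t)"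
    and p_D: "\<And>t. (p has_real_derivative p' t) (at t)"
    and p'_cont: "continuous_on UNIV p'"
    and p_0: "p 0 = 0" and p_nonneg: "\<And>t. t \<ge> 0 \<Longrightarrow> p t \<ge> 0"
    and p_nontrivial: "\<exists>t>0. p t \<noteq> 0"
    and ode: "\<And>r. r > 0 \<Longrightarrow>
      c * (r ^ (n - k) * p r ^ (k - 1) * (real (n - k) * p r / r + real k * p' r)) = r ^ (n - 1) * w r * g (U r)"
    and stab: "\<And>\<psi> \<psi>' a b. 0 < a \<Longrightarrow> (\<And>t. (\<psi> has_real_derivative \<psi>' t) (at t)) \<Longrightarrow>
      continuous_on UNIV \<psi>' \<Longrightarrow> (\<And>t. t \<notin> {a<..<b} \<Longrightarrow> \<psi> t = 0) \<Longrightarrow>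
      0 \<le> integral {a..b} (\<lambda>r. c * real k * r ^ (n - k) * p r ^ (k - 1) * (\<psi>' r)\<^sup>2
                             + r ^ (n - 1) * w r * deriv g (U r) * (\<psi> r)\<^sup>2)"
begin

definition A :: "real \<Rightarrow> real" where "A r = r ^ (n - k) * p r ^ k"
definition A' :: "real \<Rightarrow> real"
  where "A' r = r ^ (n - k) * p r ^ (k - 1) * (real (n - k) * p r / r + real k * p' r)"

lemma real_nk: "real (n - k) = real n - real k"
  using k by simp

lemma p_power_k: "p r ^ k = p r ^ (k - 1) * p r" "p r ^ (k + 1) = p r ^ (k - 1) * (p r)\<^sup>2"
  using k by (cases k; simp add: power2_eq_square)+

lemma A_D: "(A has_real_derivative A' r) (at r)" if "r > 0"
proof -
  have "((\<lambda>r. p r ^ k) has_real_derivative real k * (p' r * p r ^ (k - 1))) (at r)"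
    using DERIV_power[OF p_D[of r], of k] by simp
  from DERIV_mult[OF DERIV_power_div[where r = r and m = "n - k"] this] show ?thesis
    unfolding A_def[abs_def] using that
    by (simp only: A'_def p_power_k) (simp add: algebra_simps)
qed

lemma A'_eq: "A' r = r ^ (n - 1) * w r * g (U r) / c" if "r > 0"
  using ode[OF that] c_pos unfolding A'_def by (simp add: field_simps)

lemma A'_nonneg: "A' r \<ge> 0" if "r > 0"
  unfolding A'_eq[OF that] using that c_pos g_nonneg w_pos[OF that] by simp

lemma A_mono: "A s \<le> A t" if "0 < s" "s \<le> t"
  by (rule DERIV_nonneg_imp_nondecreasing[OF that(2)])
     (use that A_D A'_nonneg in \<open>meson less_le_trans\<close>)

definition A'' :: "real \<Rightarrow> real"
  where "A'' r = (real n - 1 + log_slope w r) / r * A' r + r ^ (n - 1) * w r * deriv g (U r) * p r / c"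

text \<open>\<open>A'\<close> involves p', which is only known to be continuous. Its
  differentiability is read off from the right-hand side of the equation, built from the
  differentiable functions w, g and U.\<close>

lemma A'_D: "(A' has_real_derivative A'' r) (at r)" if r: "r > 0"
proof -
  have "((\<lambda>r. r ^ (n - 1) * w r * g (U r) / c) has_real_derivative
      ((real (n - 1) * r ^ (n - 1) / r * w r + deriv w r * r ^ (n - 1)) * g (U r)
        + deriv g (U r) * p r * (r ^ (n - 1) * w r)) / c) (at r)"
    using r by (intro DERIV_cdivide DERIV_mult DERIV_power_div w_D DERIV_chain2[OF g_D U_D]) auto
  also have "((real (n - 1) * r ^ (n - 1) / r * w r + deriv w r * r ^ (n - 1)) * g (U r)
        + deriv g (U r) * p r * (r ^ (n - 1) * w r)) / c = A'' r"
  proof -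
    have "deriv w r = log_slope w r / r * w r" "real (n - 1) = real n - 1"
      using r w_pos[OF r] k by (auto simp: log_slope_def field_simps)
    then show ?thesis
      unfolding A''_def A'_eq[OF r] using c_pos r by (simp add: field_simps)
  qed
  finally show ?thesis
    by (rule has_field_derivative_transform_within_open[where S = "{0<..}"]) (use r A'_eq in auto)
qed

text \<open>The quadratic form with its square expanded: v^2 \<eta>^2 cancels against the v^2 in R.
  Factors r^(n-k)/r^2 keep the exponents natural even when n - k < 2.\<close>

definition J :: "(real \<Rightarrow> real) \<Rightarrow> (real \<Rightarrow> real) \<Rightarrow> real \<Rightarrow> real"
  where "J \<eta> \<eta>' r = r ^ (n - k) / r\<^sup>2 * p r ^ (k + 1) *
    ((r * \<eta>' r)\<^sup>2 + 2 * v r * (r * \<eta>' r) * \<eta> r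
      - (real n / real k * (v r + 1) - 1 - r * v' r) * (\<eta> r)\<^sup>2)"

text \<open>The boundary terms of two integrations by parts. Moving a derivative off A'' p \<eta>^2
  cancels the terms in p'^2 and in p p' \<eta> \<eta>'. What is left of p' is -(k+1) p^k p'
  r^(n-k-1) (n - k + k v) \<eta>^2, which contains the derivative of p^(k+1) and is integrated by
  parts again.\<close>

definition T :: "(real \<Rightarrow> real) \<Rightarrow> real \<Rightarrow> real"
  where "T \<eta> r = (A' r * p r - r ^ (n - k) / r * p r ^ (k + 1) * (real n - real k + real k * v r)) * (\<eta> r)\<^sup>2"

definition T' :: "(real \<Rightarrow> real) \<Rightarrow> (real \<Rightarrow> real) \<Rightarrow> real \<Rightarrow> real"
  where "T' \<eta> \<eta>' r =
    (A'' r * p r + p' r * A' r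
      - (((real n - real k - 1) * r ^ (n - k) / r\<^sup>2 * p r ^ (k + 1)
          + (real k + 1) * p r ^ k * p' r * (r ^ (n - k) / r)) * (real n - real k + real k * v r)
        + real k * v' r * (r ^ (n - k) / r * p r ^ (k + 1)))) * (\<eta> r)\<^sup>2
    + 2 * \<eta> r * \<eta>' r * (A' r * p r - r ^ (n - k) / r * p r ^ (k + 1) * (real n - real k + real k * v r))"

lemma T_D:
  assumes r: "r > 0" and \<eta>: "(\<eta> has_real_derivative \<eta>' r) (at r)"
  shows "(T \<eta> has_real_derivative T' \<eta> \<eta>' r) (at r)"
proof -
  have 1: "((\<lambda>r. r ^ (n - k) / r) has_real_derivative (real n - real k - 1) * r ^ (n - k) / r\<^sup>2) (at r)"
  proof -
    have "((\<lambda>r. r ^ (n - k) / r) has_real_derivative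
        (real (n - k) * r ^ (n - k) / r * r - r ^ (n - k) * 1) / (r * r)) (at r)"
      using r by (intro DERIV_divide DERIV_power_div DERIV_ident) auto
    moreover have "(real (n - k) * r ^ (n - k) / r * r - r ^ (n - k) * 1) / (r * r) =
        (real n - real k - 1) * r ^ (n - k) / r\<^sup>2"
      using r by (simp add: power2_eq_square) (simp add: real_nk left_diff_distrib)
    ultimately show ?thesis by simp
  qed
  have 2: "((\<lambda>r. p r ^ (k + 1)) has_real_derivative (real k + 1) * p r ^ k * p' r) (at r)"
    using DERIV_power[OF p_D[of r], of "k + 1"] by (simp add: mult_ac add.commute)
  have 3: "((\<lambda>r. (\<eta> r)\<^sup>2) has_real_derivative 2 * \<eta> r * \<eta>' r) (at r)"
    using DERIV_power[OF \<eta>, of 2] by (simp add: mult_ac)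
  have 4: "((\<lambda>r. real n - real k + real k * v r) has_real_derivative real k * v' r) (at r)"
    using r by (auto intro!: derivative_eq_intros v_D)
  show ?thesis unfolding T_def[abs_def] T'_def
    by (intro DERIV_mult DERIV_diff A'_D[OF r] p_D 1 2 3 4)
qed

text \<open>\<open>A''_def\<close> trades g'(U) for A'' and A'. The denominator k + 1 in v is what
  makes the coefficient of p^k p' \<eta>^2 factor as (k+1)(n - k + k v), so that both integrations
  by parts close up.\<close>

lemma second_variation_identity:
  assumes r: "r > 0"
  shows "c * real k * r ^ (n - k) * p r ^ (k - 1) * (p' r * \<eta> r + \<eta>' r * p r)\<^sup>2
      + r ^ (n - 1) * w r * deriv g (U r) * (p r * \<eta> r)\<^sup>2
    = c * (real k * J \<eta> \<eta>' r + T' \<eta> \<eta>' r)"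
proof -
  define N K where "N = real n" and "K = real k"
  define P where "P = p r ^ (k - 1)"
  define \<sigma> where "\<sigma> = r ^ (n - k) / r\<^sup>2"
  have \<sigma>: "r ^ (n - k) = \<sigma> * r\<^sup>2" using r by (simp add: \<sigma>_def)
  have "r ^ (n - 1) * w r * deriv g (U r) * p r = c * (A'' r - (N - 1 + log_slope w r) / r * A' r)"
    unfolding A''_def N_def using c_pos by simp
  then have second: "r ^ (n - 1) * w r * deriv g (U r) * (p r * \<eta> r)\<^sup>2 =
      c * ((A'' r - (N - 1 + log_slope w r) / r * A' r) * (p r * (\<eta> r)\<^sup>2))"
    by (simp add: power2_eq_square mult.assoc[symmetric])
  have A': "A' r = \<sigma> * r * P * ((N - K) * p r + K * r * p' r)"
    unfolding A'_def \<sigma> P_def[symmetric] real_nk N_def[symmetric] K_def[symmetric]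
    using r by (simp add: power2_eq_square field_simps)
  have A'_r: "(N - 1 + log_slope w r) / r * A' r =
      (N - 1 + ((K + 1) * v r - (K - 1))) * (\<sigma> * P * ((N - K) * p r + K * r * p' r))"
    unfolding A' log_slope_eq K_def[symmetric] using r by simp
  have J: "K * J \<eta> \<eta>' r = \<sigma> * (P * (p r)\<^sup>2) * (K * (r * \<eta>' r)\<^sup>2 + 2 * K * v r * (r * \<eta>' r) * \<eta> r
      - (N * (v r + 1) - K - K * r * v' r) * (\<eta> r)\<^sup>2)"
  proof -
    have "K \<noteq> 0" using k_pos by (simp add: K_def)
    then have "K * (N / K * (v r + 1) - 1 - r * v' r) = N * (v r + 1) - K - K * r * v' r"
      by (simp add: right_diff_distrib)
    then have *: "K * ((r * \<eta>' r)\<^sup>2 + 2 * v r * (r * \<eta>' r) * \<eta> r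
        - (N / K * (v r + 1) - 1 - r * v' r) * (\<eta> r)\<^sup>2) =
      K * (r * \<eta>' r)\<^sup>2 + 2 * K * v r * (r * \<eta>' r) * \<eta> r
      - (N * (v r + 1) - K - K * r * v' r) * (\<eta> r)\<^sup>2"
      by (simp add: right_diff_distrib distrib_left mult.assoc[symmetric])
    show ?thesis
      unfolding J_def p_power_k P_def[symmetric] N_def[symmetric] K_def[symmetric] \<sigma>_def[symmetric] *[symmetric]
      by (simp only: mult_ac)
  qed
  have "\<sigma> * r\<^sup>2 / r = \<sigma> * r" "(N - K - 1) * (\<sigma> * r\<^sup>2) / r\<^sup>2 = (N - K - 1) * \<sigma>"
    using r by (simp_all add: power2_eq_square)
  note simps = this
  have T': "T' \<eta> \<eta>' r = (A'' r * p r + p' r * (\<sigma> * r * P * ((N - K) * p r + K * r * p' r))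
      - (((N - K - 1) * \<sigma> * (P * (p r)\<^sup>2)
          + (K + 1) * (P * p r) * p' r * (\<sigma> * r)) * (N - K + K * v r)
        + K * v' r * (\<sigma> * r * (P * (p r)\<^sup>2)))) * (\<eta> r)\<^sup>2
    + 2 * \<eta> r * \<eta>' r * ((\<sigma> * r * P * ((N - K) * p r + K * r * p' r)) * p r
        - \<sigma> * r * (P * (p r)\<^sup>2) * (N - K + K * v r))"
    unfolding T'_def p_power_k A' P_def[symmetric] N_def[symmetric] K_def[symmetric] \<sigma> simps ..
  have "c * K * (\<sigma> * r\<^sup>2) * P * (p' r * \<eta> r + \<eta>' r * p r)\<^sup>2
      + c * ((A'' r - (N - 1 + ((K + 1) * v r - (K - 1))) * (\<sigma> * P * ((N - K) * p r + K * r * p' r))) * (p r * (\<eta> r)\<^sup>2))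
    = c * (K * J \<eta> \<eta>' r + T' \<eta> \<eta>' r)"
    unfolding J T' by (simp add: power2_eq_square algebra_simps)
  then show ?thesis
    unfolding second A'_r unfolding \<sigma> P_def[symmetric] K_def[symmetric] .
qed

lemma p_cont: "continuous_on S p"
  by (intro continuous_at_imp_continuous_on ballI DERIV_isCont[OF p_D])

lemma J_cont:
  assumes "continuous_on UNIV \<eta>" "continuous_on UNIV \<eta>'" "0 < a"
  shows "continuous_on {a..b} (J \<eta> \<eta>')"
  unfolding J_def[abs_def] using assms(3)
  by (intro continuous_intros p_cont continuous_on_subset[OF assms(1)] continuous_on_subset[OF assms(2)]
       continuous_on_subset[OF v_cont] continuous_on_subset[OF v'_cont]) auto

lemma integral_J_nonneg:
  assumes a: "0 < a" "a \<le> b" and D: "\<And>t. (\<eta> has_real_derivative \<eta>' t) (at t)"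
    and cont: "continuous_on UNIV \<eta>'" and supp: "\<And>t. t \<notin> {a<..<b} \<Longrightarrow> \<eta> t = 0"
  shows "0 \<le> integral {a..b} (J \<eta> \<eta>')"
proof -
  have \<eta>_cont: "continuous_on UNIV \<eta>"
    by (intro DERIV_continuous_on) (use D in auto)
  have "(T' \<eta> \<eta>' has_integral T \<eta> b - T \<eta> a) {a..b}"
    using T_D[where \<eta> = \<eta> and \<eta>' = \<eta>', OF _ D] a
    by (intro fundamental_theorem_of_calculus)
       (auto simp: has_field_derivative_at_within simp flip: has_real_derivative_iff_has_vector_derivative)
  then have T': "(T' \<eta> \<eta>' has_integral 0) {a..b}"
    using supp[of a] supp[of b] by (simp add: T_def)
  have J: "(J \<eta> \<eta>' has_integral integral {a..b} (J \<eta> \<eta>')) {a..b}"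
    by (intro integrable_integral integrable_continuous_interval J_cont \<eta>_cont cont a)
  have "((\<lambda>r. c * (real k * J \<eta> \<eta>' r + T' \<eta> \<eta>' r)) has_integral
      c * (real k * integral {a..b} (J \<eta> \<eta>') + 0)) {a..b}"
    by (intro has_integral_mult_right has_integral_add J T')
  note integral_unique[OF this]
  moreover have "0 \<le> integral {a..b} (\<lambda>r. c * real k * r ^ (n - k) * p r ^ (k - 1) * (p' r * \<eta> r + \<eta>' r * p r)\<^sup>2
      + r ^ (n - 1) * w r * deriv g (U r) * (p r * \<eta> r)\<^sup>2)"
    by (intro stab[where \<psi> = "\<lambda>r. p r * \<eta> r" and \<psi>' = "\<lambda>r. p' r * \<eta> r + \<eta>' r * p r"] a(1))
       (auto intro!: DERIV_mult p_D D continuous_intros p'_cont \<eta>_cont cont p_cont simp: supp)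
  moreover have "\<dots> = integral {a..b} (\<lambda>r. c * (real k * J \<eta> \<eta>' r + T' \<eta> \<eta>' r))"
    by (intro Henstock_Kurzweil_Integration.integral_cong second_variation_identity) (use a in auto)
  ultimately have "0 \<le> c * (real k * integral {a..b} (J \<eta> \<eta>') + 0)" by (simp only:)
  then show ?thesis using c_pos k_pos by (simp add: zero_le_mult_iff)
qed

text \<open>A zero of p at r forces p = 0 on [0, r] by monotonicity of \<open>A\<close>, hence g(U)
  = 0 at an interior point. As g is nonincreasing and nonnegative and U nondecreasing, g(U) stays 0
  from there on; \<open>A\<close> is then constantly 0, against nontriviality.\<close>

lemma p_pos: "p r > 0" if r: "r > 0"
proof (rule ccontr)
  assume "\<not> p r > 0"
  then have pr: "p r = 0" using p_nonneg[of r] r by simp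
  have p0: "p s = 0" if s: "s \<in> {0..r}" for s
  proof (cases "s = 0")
    case False
    with s have "A s \<le> A r" by (intro A_mono) auto
    also have "A r = 0" using pr k by (simp add: A_def)
    finally have "s ^ (n - k) * p s ^ k \<le> 0" by (simp add: A_def)
    moreover have "s ^ (n - k) > 0" using s False by simp
    ultimately have "p s ^ k \<le> 0" by (simp add: mult_le_0_iff)
    then show ?thesis using p_nonneg[of s] s by (metis atLeastAtMost_iff linorder_not_le order_le_less zero_less_power)
  qed (use p_0 in simp)
  \<comment> \<open>Strictly inside (0, r), so that p vanishes on a neighbourhood of s and p' s =
    0.\<close>
  define s where "s = r / 2"
  have s: "0 < s" "s < r" using r by (auto simp: s_def)
  have "p' s = 0"
  proof (rule DERIV_unique[OF p_D])
    show "(p has_real_derivative 0) (at s)"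
      by (rule has_field_derivative_transform_within_open[of "\<lambda>_. 0" _ _ "{0<..<r}"]) (use s p0 in auto)
  qed
  then have "A' s = 0" using p0[of s] s by (simp add: A'_def)
  then have "g (U s) = 0" using A'_eq[OF s(1)] s c_pos w_pos[OF s(1)] by simp
  have "A t = 0" if "t > 0" for t
  proof (cases "t \<le> s")
    case True
    then show ?thesis using p0[of t] that s k by (simp add: A_def)
  next
    case False
    have "A t = A s"
    proof (rule DERIV_isconst_end[where f = A])
      show "s < t" using False by simp
      show "continuous_on {s..t} A"
        using s by (auto intro!: continuous_at_imp_continuous_on DERIV_isCont[OF A_D])
      fix x assume x: "s < x" "x < t"
      have "U s \<le> U x"
      proof (rule DERIV_nonneg_imp_nondecreasing[where f = U])
        fix z assume "s \<le> z"
        then show "\<exists>y. (U has_real_derivative y) (at z) \<and> 0 \<le> y"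
          using U_D p_nonneg[of z] s by auto
      qed (use x in simp)
      then have "g (U x) = 0"
        using g_antimono g_nonneg[of "U x"] \<open>g (U s) = 0\<close> by (metis antimonoD order_antisym)
      then have "A' x = 0" using A'_eq[of x] x s by simp
      then show "(A has_real_derivative 0) (at x)" using A_D[of x] x s by simp
    qed
    also have "A s = 0" using p0[of s] s k by (simp add: A_def)
    finally show ?thesis .
  qed
  then have "p t = 0" if "t > 0" for t
    using that by (force simp: A_def)
  then show False using p_nontrivial by auto
qed

end

section \<open>Test functions\<close>

lemma DERIV_max_0_square: "((\<lambda>x. (max 0 x)\<^sup>2) has_real_derivative 2 * max 0 x) (at x)" for x :: real
proof (cases x "0::real" rule: linorder_cases)
  case less
  have "((\<lambda>x. 0) has_real_derivative 0) (at x)" by simp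
  then have "((\<lambda>x. (max 0 x)\<^sup>2) has_real_derivative 0) (at x)"
    by (rule has_field_derivative_transform_within_open[where S = "{..<0}"]) (use less in auto)
  with less show ?thesis by simp
next
  case greater
  have "((\<lambda>x. x\<^sup>2) has_real_derivative 2 * x) (at x)" by (auto intro!: derivative_eq_intros)
  then have "((\<lambda>x. (max 0 x)\<^sup>2) has_real_derivative 2 * x) (at x)"
    by (rule has_field_derivative_transform_within_open[where S = "{0<..}"]) (use greater in auto)
  with greater show ?thesis by simp
next
  case equal
  have "((\<lambda>h. ((max 0 h)\<^sup>2) / h) \<longlongrightarrow> 0) (at (0::real))"
  proof (rule tendsto_sandwich)
    show "\<forall>\<^sub>F h::real in at 0. - \<bar>h\<bar> \<le> (max 0 h)\<^sup>2 / h"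
      by (intro always_eventually allI) (simp add: power2_eq_square max_def)
    show "\<forall>\<^sub>F h::real in at 0. (max 0 h)\<^sup>2 / h \<le> \<bar>h\<bar>"
      by (intro always_eventually allI) (simp add: power2_eq_square max_def)
    have "((\<lambda>h::real. - \<bar>h\<bar>) \<longlongrightarrow> - \<bar>0\<bar>) (at 0)" "((\<lambda>h::real. \<bar>h\<bar>) \<longlongrightarrow> \<bar>0\<bar>) (at 0)"
      by (intro tendsto_intros)+
    then show "((\<lambda>h::real. - \<bar>h\<bar>) \<longlongrightarrow> 0) (at 0)" "((\<lambda>h::real. \<bar>h\<bar>) \<longlongrightarrow> 0) (at 0)" by simp_all
  qed
  then show ?thesis by (simp add: equal DERIV_def)
qed

text \<open>Equal to 1 for x \<le> 0, to (1 - x^2)^2 on [0, 1] and to 0 for x \<ge> 1. The inner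
  square matches the slope at 0, the outer one makes the zero at 1 double, so the function is
  C^1.\<close>

definition cutoff :: "real \<Rightarrow> real" where "cutoff x = (max 0 (1 - (max 0 x)\<^sup>2))\<^sup>2"
definition cutoff' :: "real \<Rightarrow> real" where "cutoff' x = - 4 * (max 0 (1 - (max 0 x)\<^sup>2) * max 0 x)"

lemma cutoff_D: "(cutoff has_real_derivative cutoff' x) (at x)"
proof -
  have "((\<lambda>x. 1 - (max 0 x)\<^sup>2) has_real_derivative 0 - 2 * max 0 x) (at x)"
    by (intro DERIV_diff DERIV_const DERIV_max_0_square)
  from DERIV_chain2[OF DERIV_max_0_square this] show ?thesis
    unfolding cutoff_def[abs_def] cutoff'_def by (simp add: mult_ac)
qed

lemma cutoff'_cont: "continuous_on S cutoff'"
  unfolding cutoff'_def[abs_def] by (intro continuous_intros)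

lemma cutoff_eq_1: "cutoff x = 1" "cutoff' x = 0" if "x \<le> 0"
  using that by (auto simp: cutoff_def cutoff'_def)

lemma cutoff_eq_0: "cutoff x = 0" "cutoff' x = 0" if "x \<ge> 1"
proof -
  have "1 \<le> (max 0 x)\<^sup>2" using that by (simp add: one_le_power)
  then show "cutoff x = 0" "cutoff' x = 0" by (auto simp: cutoff_def cutoff'_def)
qed

lemma cutoff_bounds: "0 \<le> cutoff x" "cutoff x \<le> 1" "\<bar>cutoff' x\<bar> \<le> 4" "cutoff' x \<le> 0"
proof -
  have m: "0 \<le> max 0 (1 - (max 0 x)\<^sup>2)" "max 0 (1 - (max 0 x)\<^sup>2) \<le> 1" by auto
  show "0 \<le> cutoff x" "cutoff x \<le> 1" using m by (auto simp: cutoff_def power_le_one)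
  show "cutoff' x \<le> 0" using m by (simp add: cutoff'_def)
  show "\<bar>cutoff' x\<bar> \<le> 4"
  proof (cases "x \<ge> 1")
    case False
    then have "max 0 (1 - (max 0 x)\<^sup>2) * max 0 x \<le> 1 * 1" using m by (intro mult_mono) auto
    then show ?thesis using m by (simp add: cutoff'_def abs_mult)
  qed (simp add: cutoff_eq_0)
qed

section \<open>Test functions with two cutoffs and the second variation on each piece\<close>

locale supercritical_sol = radial_sol + supercritical_weight
begin

(* The ramp on [1, 2] makes the test function C^1 where its plateau ends; max s 1 keeps rate
   continuous on the whole line. *)
definition rate :: "real \<Rightarrow> real" where "rate s = max 0 (min 1 (s - 1)) * y (max s 1) / max s 1"

lemma rate_cont: "continuous_on UNIV rate"
  unfolding rate_def[abs_def]
  by (intro continuous_intros continuous_on_compose2[OF y_cont]) auto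

text \<open>An antiderivative on the whole line, hence differentiable from both sides everywhere. It
  vanishes for r \<le> 1 and differs from \<open>E\<close> by a constant for r \<ge> 2, so exp (- H
  r) is there a multiple of r^(-\<alpha>(r)).\<close>

definition H :: "real \<Rightarrow> real"
  where "H = (SOME F. (\<forall>x. (F has_real_derivative rate x) (at x)) \<and> F 1 = 0)"

lemma H_D: "(H has_real_derivative rate x) (at x)" and H_1: "H 1 = 0"
proof -
  have "\<exists>F. \<forall>x::real. (F has_vector_derivative rate x) (at x)"
    using einterval_antiderivative[of "-\<infinity>" "\<infinity>" rate] rate_cont
    by (auto simp: continuous_on_eq_continuous_at)
  then obtain F where F: "\<And>x. (F has_real_derivative rate x) (at x)"
    by (auto simp: has_real_derivative_iff_has_vector_derivative)
  have "\<exists>F. (\<forall>x. (F has_real_derivative rate x) (at x)) \<and> F 1 = 0"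
    by (rule exI[of _ "\<lambda>x. F x - F 1"]) (auto intro!: derivative_eq_intros F)
  from someI_ex[OF this] show "(H has_real_derivative rate x) (at x)" "H 1 = 0"
    unfolding H_def by auto
qed

lemma rate_eq_0: "rate s = 0" if "s \<le> 1"
  using that by (simp add: rate_def)

lemma rate_eq: "rate s = y s / s" if "s \<ge> 2"
  using that by (simp add: rate_def max_def)

lemma r_rate: "r * rate r = max 0 (min 1 (r - 1)) * y r" if "r \<ge> 1"
  using that by (simp add: rate_def max_def)

lemma H_eq_0: "H s = 0" if "s \<le> 1"
proof (cases "s = 1")
  case False
  have "H 1 = H s"
  proof (rule DERIV_isconst_end[where f = H])
    show "continuous_on {s..1} H"
      by (intro continuous_at_imp_continuous_on ballI DERIV_isCont[OF H_D])
    fix x :: real assume "x < 1"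
    then show "(H has_real_derivative 0) (at x)" using H_D[of x] by (simp add: rate_eq_0)
  qed (use False that in auto)
  then show ?thesis by (simp add: H_1)
qed (simp add: H_1)

lemma H_diff: "H t - H s = integral {s..t} (\<lambda>r. y r / r)" if "2 \<le> s" "s \<le> t"
proof -
  have "(rate has_integral H t - H s) {s..t}"
    using that H_D
    by (intro fundamental_theorem_of_calculus)
       (auto simp: has_field_derivative_at_within simp flip: has_real_derivative_iff_has_vector_derivative)
  then have "H t - H s = integral {s..t} rate" by (simp add: integral_unique)
  also have "\<dots> = integral {s..t} (\<lambda>r. y r / r)"
    using that by (intro Henstock_Kurzweil_Integration.integral_cong rate_eq) auto
  finally show ?thesis .
qed

lemma H_eq_E: "H r = E r + (H 2 - E 2)" if "r \<ge> 2"
  using H_diff[of 2 r] E_diff[of 2 r] that by simp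

text \<open>The inner cutoff rises from 0 to 1 on [\<epsilon>, 2\<epsilon>], the outer one falls
  from 1 to 0 on [\<rho>, 2\<rho>].\<close>

definition \<eta> :: "real \<Rightarrow> real \<Rightarrow> real \<Rightarrow> real"
  where "\<eta> \<epsilon> \<rho> r = cutoff (2 - r / \<epsilon>) * cutoff (r / \<rho> - 1) * exp (- H r)"
definition \<eta>' :: "real \<Rightarrow> real \<Rightarrow> real \<Rightarrow> real"
  where "\<eta>' \<epsilon> \<rho> r = - cutoff' (2 - r / \<epsilon>) / \<epsilon> * cutoff (r / \<rho> - 1) * exp (- H r)
    + cutoff (2 - r / \<epsilon>) * (cutoff' (r / \<rho> - 1) / \<rho>) * exp (- H r)
    - cutoff (2 - r / \<epsilon>) * cutoff (r / \<rho> - 1) * exp (- H r) * rate r"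

lemma \<eta>_D: "(\<eta> \<epsilon> \<rho> has_real_derivative \<eta>' \<epsilon> \<rho> r) (at r)" if "\<epsilon> > 0" "\<rho> > 0"
proof -
  have 1: "((\<lambda>r. cutoff (2 - r / \<epsilon>)) has_real_derivative cutoff' (2 - r / \<epsilon>) * (- 1 / \<epsilon>)) (at r)"
    by (rule DERIV_chain2[OF cutoff_D]) (use that in \<open>auto intro!: derivative_eq_intros\<close>)
  have 2: "((\<lambda>r. cutoff (r / \<rho> - 1)) has_real_derivative cutoff' (r / \<rho> - 1) * (1 / \<rho>)) (at r)"
    by (rule DERIV_chain2[OF cutoff_D]) (use that in \<open>auto intro!: derivative_eq_intros\<close>)
  have 3: "((\<lambda>r. exp (- H r)) has_real_derivative exp (- H r) * - rate r) (at r)"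
    by (rule DERIV_chain2[OF DERIV_exp]) (intro DERIV_minus H_D)
  show ?thesis
    unfolding \<eta>_def[abs_def] \<eta>'_def
    by (rule DERIV_cong[OF DERIV_mult[OF DERIV_mult[OF 1 2] 3]]) (simp add: algebra_simps)
qed

lemma \<eta>'_cont: "continuous_on UNIV (\<eta>' \<epsilon> \<rho>)" if "\<epsilon> > 0" "\<rho> > 0"
proof -
  have c: "continuous_on UNIV cutoff" "continuous_on UNIV H"
    by (intro DERIV_continuous_on; rule cutoff_D H_D)+
  show ?thesis
    unfolding \<eta>'_def[abs_def] using that
    by (intro continuous_intros continuous_on_compose2[OF c(1)] continuous_on_compose2[OF cutoff'_cont[of UNIV]]
         c rate_cont) auto
qed

definition \<omega> :: "real \<Rightarrow> real" where "\<omega> r = r ^ (n - k) / r\<^sup>2 * p r ^ (k + 1)"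

lemma \<omega>_pos: "\<omega> r > 0" if "r > 0"
  unfolding \<omega>_def using that p_pos[OF that] by simp

lemma \<omega>_cont: "0 < a \<Longrightarrow> continuous_on {a..b} \<omega>"
  unfolding \<omega>_def[abs_def] by (intro continuous_intros p_cont) auto

lemma J_eq: "J \<phi> \<phi>' r = \<omega> r * ((r * \<phi>' r)\<^sup>2 + 2 * v r * (r * \<phi>' r) * \<phi> r
      - (real n / real k * (v r + 1) - 1 - r * v' r) * (\<phi> r)\<^sup>2)"
  by (simp add: J_def \<omega>_def)

lemma J_eq_square: "J \<phi> \<phi>' r = \<omega> r * ((r * \<phi>' r + v r * \<phi> r)\<^sup>2 - R r * (\<phi> r)\<^sup>2)"
  unfolding J_eq R_eq_potential by (simp add: power2_eq_square algebra_simps)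

text \<open>From p(0) = 0 and the boundedness of p' on [0, 1] one has p \<le> b r there, so \<omega>
  is at most b^(k+1) r^(n-1). An interval of length \<epsilon> thus contributes
  O(\<epsilon>).\<close>

lemma \<omega>_bound:
  obtains B where "B \<ge> 0" "\<And>r. 0 < r \<Longrightarrow> r \<le> 1 \<Longrightarrow> \<omega> r \<le> B"
proof -
  have "bounded (p' ` {0..1})"
    by (intro compact_imp_bounded compact_continuous_image continuous_on_subset[OF p'_cont]) auto
  then obtain b where b: "\<forall>r\<in>{0..1}. \<bar>p' r\<bar> \<le> b"
    by (auto simp: bounded_iff)
  have b0: "b \<ge> 0" using b by force
  have p_le: "p r \<le> b * r" if r: "0 < r" "r \<le> 1" for r
  proof -
    obtain z where z: "0 < z" "z < r" "p r - p 0 = (r - 0) * p' z"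
      using MVT2[OF r(1), of p p'] p_D by auto
    have "z \<in> {0..1}" using z r by simp
    then have "p' z \<le> b" using b by force
    then have "r * p' z \<le> r * b" using r by (intro mult_left_mono) auto
    then show ?thesis using z p_0 by (simp add: mult.commute)
  qed
  show thesis
  proof (rule that[of "b ^ (k + 1)"])
    fix r :: real assume r: "0 < r" "r \<le> 1"
    have "\<omega> r \<le> r ^ (n - k) / r\<^sup>2 * (b * r) ^ (k + 1)"
      unfolding \<omega>_def using r p_le p_nonneg[of r] by (intro mult_left_mono power_mono) auto
    also have "\<dots> = b ^ (k + 1) * (r ^ (n - k) * r ^ (k - 1))"
      using r k by (cases k) (auto simp: power_mult_distrib power2_eq_square)
    also have "\<dots> \<le> b ^ (k + 1) * (1 * 1)"
      using r b0 by (intro mult_left_mono mult_mono power_le_one) auto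
    finally show "\<omega> r \<le> b ^ (k + 1)" by simp
  qed (use b0 in simp)
qed

text \<open>r \<eta>' is scale invariant: r/\<epsilon> \<le> 2 and |cutoff'| \<le> 4 bound it by 8
  for every \<epsilon>. This gives 64 = 8^2 and 16 = 2 * 8; the potential term is dropped by its
  sign.\<close>

lemma J_inner_le:
  assumes r: "\<epsilon> \<le> r" "r \<le> 2 * \<epsilon>" and \<epsilon>: "0 < \<epsilon>" "\<epsilon> \<le> 1 / 4" and \<rho>: "\<rho> \<ge> 2"
  shows "J (\<eta> \<epsilon> \<rho>) (\<eta>' \<epsilon> \<rho>) r \<le> \<omega> r * (64 + 16 * (\<bar>q\<bar> + \<bar>q0\<bar>))"
proof -
  have r0: "0 < r" "r \<le> 1" using r \<epsilon> by auto
  have out: "r / \<rho> - 1 \<le> 0" using r0 \<rho> by (simp add: divide_le_eq)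
  define x where "x = cutoff (2 - r / \<epsilon>)"
  define d where "d = r * (- cutoff' (2 - r / \<epsilon>) / \<epsilon>)"
  have \<eta>: "\<eta> \<epsilon> \<rho> r = x" "r * \<eta>' \<epsilon> \<rho> r = d"
    unfolding \<eta>_def \<eta>'_def x_def d_def using out r0 by (simp_all add: cutoff_eq_1 H_eq_0 rate_eq_0)
  have x: "0 \<le> x" "x \<le> 1" unfolding x_def by (rule cutoff_bounds)+
  have "\<bar>d\<bar> = r / \<epsilon> * \<bar>cutoff' (2 - r / \<epsilon>)\<bar>"
    using r0 \<epsilon> by (simp add: d_def abs_mult)
  also have "\<dots> \<le> 2 * 4"
    using r \<epsilon> r0 cutoff_bounds by (intro mult_mono) (auto simp: divide_le_eq)
  finally have d: "\<bar>d\<bar> \<le> 8" by simp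
  have "d\<^sup>2 \<le> 64" using d abs_le_square_iff[of d 8] by simp
  moreover have "\<bar>2 * v r * d * x\<bar> \<le> 2 * (\<bar>q\<bar> + \<bar>q0\<bar>) * 8 * 1"
    unfolding abs_mult using abs_v_bound[OF r0(1)] d x by (intro mult_mono) auto
  moreover have "0 \<le> (real n / real k * (v r + 1) - 1 - r * v' r) * x\<^sup>2"
    using potential_ge[OF r0(1)] c1_pos by (intro mult_nonneg_nonneg) auto
  ultimately have "d\<^sup>2 + 2 * v r * d * x - (real n / real k * (v r + 1) - 1 - r * v' r) * x\<^sup>2
      \<le> 64 + 16 * (\<bar>q\<bar> + \<bar>q0\<bar>)" by linarith
  then show ?thesis unfolding J_eq \<eta> using \<omega>_pos[OF r0(1)] by (intro mult_left_mono) auto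
qed

lemma J_plateau:
  assumes r: "2 * \<epsilon> \<le> r" "r \<le> 1" and \<epsilon>: "0 < \<epsilon>" and \<rho>: "\<rho> \<ge> 2"
  shows "J (\<eta> \<epsilon> \<rho>) (\<eta>' \<epsilon> \<rho>) r \<le> - c1 * \<omega> r"
proof -
  have r0: "0 < r" using r \<epsilon> by auto
  have "r / \<rho> - 1 \<le> 0" "2 - r / \<epsilon> \<le> 0" using r0 r \<rho> \<epsilon> by (auto simp: field_simps)
  then have \<eta>: "\<eta> \<epsilon> \<rho> r = 1" "r * \<eta>' \<epsilon> \<rho> r = 0"
    unfolding \<eta>_def \<eta>'_def using r by (simp_all add: cutoff_eq_1 H_eq_0 rate_eq_0)
  define P where "P = real n / real k * (v r + 1) - 1 - r * v' r"
  have "J (\<eta> \<epsilon> \<rho>) (\<eta>' \<epsilon> \<rho>) r = - (\<omega> r * P)"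
    unfolding J_eq \<eta> P_def[symmetric] by simp
  moreover have "\<omega> r * c1 \<le> \<omega> r * P"
    using \<omega>_pos[OF r0] potential_ge[OF r0] unfolding P_def by (intro mult_left_mono) auto
  ultimately show ?thesis by (simp add: mult.commute)
qed

text \<open>On the ramp r \<eta>' + v \<eta> = (v - \<theta> y) \<eta>, where v - \<theta> y runs
  from v to -sqrt R as \<theta> goes from 0 to 1. Both ends lie in [-sqrt R, sqrt R], so switching
  on the decay gradually never makes the integrand positive.\<close>

lemma J_middle:
  assumes r: "1 \<le> r" "r \<le> \<rho>" and \<epsilon>: "0 < \<epsilon>" "\<epsilon> \<le> 1 / 4"
  shows "J (\<eta> \<epsilon> \<rho>) (\<eta>' \<epsilon> \<rho>) r \<le> 0"
proof -
  have r0: "0 < r" using r by auto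
  define \<theta> where "\<theta> = max 0 (min 1 (r - 1))"
  define e where "e = exp (- H r)"
  have "r / \<rho> - 1 \<le> 0" "2 - r / \<epsilon> \<le> 0" using r0 r \<epsilon> by (auto simp: field_simps)
  then have \<eta>: "\<eta> \<epsilon> \<rho> r = e" "\<eta>' \<epsilon> \<rho> r = - e * rate r"
    unfolding \<eta>_def \<eta>'_def e_def by (simp_all add: cutoff_eq_1)
  have sq: "r * \<eta>' \<epsilon> \<rho> r + v r * \<eta> \<epsilon> \<rho> r = (v r - \<theta> * y r) * e"
    unfolding \<eta> using r_rate[OF r(1)] by (simp add: \<theta>_def algebra_simps)
  have J: "J (\<eta> \<epsilon> \<rho>) (\<eta>' \<epsilon> \<rho>) r = \<omega> r * e\<^sup>2 * ((v r - \<theta> * y r)\<^sup>2 - R r)"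
    unfolding J_eq_square unfolding sq unfolding \<eta>(1) by (simp only: power_mult_distrib) (simp add: right_diff_distrib mult_ac)
  have \<theta>: "0 \<le> \<theta>" "\<theta> \<le> 1" by (auto simp: \<theta>_def)
  have "0 \<le> \<theta> * y r" "\<theta> * y r \<le> 1 * y r"
    using \<theta>(1) mult_right_mono[OF \<theta>(2) y_nonneg[OF r0]] y_nonneg[OF r0] by simp_all
  then have "\<bar>v r - \<theta> * y r\<bar> \<le> sqrt (R r)"
    using abs_v_le[OF r0] y_def[of r] by linarith
  then have "\<bar>v r - \<theta> * y r\<bar>\<^sup>2 \<le> (sqrt (R r))\<^sup>2" by (intro power_mono) auto
  then have "(v r - \<theta> * y r)\<^sup>2 \<le> R r" using R_pos[OF r0] by simp
  then show ?thesis unfolding J using \<omega>_pos[OF r0] by (intro mult_nonneg_nonpos) auto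
qed

text \<open>With \<eta> = x e the exponential decay turns the square into (d - x sqrt R)^2 e^2, and
  x^2 R cancels. Only d^2 - 2 x d sqrt R remains, with |d| \<le> 8 as in the inner region.\<close>

lemma J_outer:
  assumes r: "\<rho> \<le> r" "r \<le> 2 * \<rho>" and \<rho>: "2 \<le> \<rho>" and \<epsilon>: "0 < \<epsilon>" "\<epsilon> \<le> 1 / 4"
  shows "J (\<eta> \<epsilon> \<rho>) (\<eta>' \<epsilon> \<rho>) r \<le> \<omega> r * exp (- 2 * H r) * (64 + 16 * sqrt (R r))"
proof -
  have r0: "0 < r" "2 \<le> r" using r \<rho> by auto
  define x where "x = cutoff (r / \<rho> - 1)"
  define d where "d = r * (cutoff' (r / \<rho> - 1) / \<rho>)"
  define e where "e = exp (- H r)"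
  define S where "S = sqrt (R r)"
  have S: "S\<^sup>2 = R r" "0 \<le> S" using R_pos[OF r0(1)] by (auto simp: S_def)
  have "2 - r / \<epsilon> \<le> 0" using r0 \<epsilon> by (simp add: field_simps)
  then have \<eta>: "\<eta> \<epsilon> \<rho> r = x * e" "r * \<eta>' \<epsilon> \<rho> r = (d - x * y r) * e"
    unfolding \<eta>_def \<eta>'_def x_def d_def e_def using r0 by (simp_all add: cutoff_eq_1 rate_eq algebra_simps)
  have sq: "r * \<eta>' \<epsilon> \<rho> r + v r * \<eta> \<epsilon> \<rho> r = (d - x * S) * e"
    unfolding \<eta> y_def S_def by (simp add: algebra_simps)
  have J: "J (\<eta> \<epsilon> \<rho>) (\<eta>' \<epsilon> \<rho>) r = \<omega> r * e\<^sup>2 * (d\<^sup>2 - 2 * (S * x * d))"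
    unfolding J_eq_square unfolding sq unfolding \<eta>(1) S(1)[symmetric]
    by (simp only: power_mult_distrib) (simp add: power2_eq_square algebra_simps)
  have x: "0 \<le> x" "x \<le> 1" unfolding x_def by (rule cutoff_bounds)+
  have "\<bar>d\<bar> = r / \<rho> * \<bar>cutoff' (r / \<rho> - 1)\<bar>"
    using r0 \<rho> by (simp add: d_def abs_mult)
  also have "\<dots> \<le> 2 * 4"
    using r \<rho> r0 cutoff_bounds by (intro mult_mono) (auto simp: divide_le_eq)
  finally have d: "\<bar>d\<bar> \<le> 8" by simp
  have "d\<^sup>2 \<le> 64" using d abs_le_square_iff[of d 8] by simp
  moreover have "\<bar>S * x * d\<bar> \<le> S * 1 * 8"
    unfolding abs_mult using S x d by (intro mult_mono) auto
  ultimately have "d\<^sup>2 - 2 * (S * x * d) \<le> 64 + 16 * S" by linarith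
  then have "\<omega> r * e\<^sup>2 * (d\<^sup>2 - 2 * (S * x * d)) \<le> \<omega> r * e\<^sup>2 * (64 + 16 * S)"
    using \<omega>_pos[OF r0(1)] by (intro mult_left_mono) auto
  moreover have "e\<^sup>2 = exp (- 2 * H r)" using exp_double[of "- H r"] by (simp add: e_def)
  ultimately show ?thesis unfolding J S_def by simp
qed

end

section \<open>Lower bounds for radial solutions\<close>

lemma power_eq_exp_ln: "(r::real) > 0 \<Longrightarrow> r ^ a = exp (real a * ln r)"
  by (simp add: exp_of_nat_mult)

context supercritical_sol
begin

text \<open>Monotonicity of \<open>A\<close> bounds p on [\<rho>, 2\<rho>] by its value at the right
  end; this later turns an integral bound into a pointwise bound at 2\<rho>.\<close>

lemma p_doubling:
  assumes r: "0 < \<rho>" "\<rho> \<le> r" "r \<le> 2 * \<rho>"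
  shows "p r \<le> 2 ^ (n - k) * p (2 * \<rho>)"
proof -
  let ?m = "n - k" and ?P = "p (2 * \<rho>)"
  have P: "?P > 0" using p_pos r by simp
  have "r ^ ?m * p r ^ k \<le> (2 * \<rho>) ^ ?m * ?P ^ k"
    using A_mono[of r "2 * \<rho>"] r unfolding A_def by simp
  also have "\<dots> \<le> (2 * r) ^ ?m * ?P ^ k"
    using r P by (intro mult_right_mono power_mono) auto
  finally have "r ^ ?m * p r ^ k \<le> r ^ ?m * (2 ^ ?m * ?P ^ k)"
    by (simp add: power_mult_distrib mult_ac)
  then have "p r ^ k \<le> 2 ^ ?m * ?P ^ k" using r by simp
  \<comment> \<open>The factor is enlarged to a k-th power, so that comparing bases replaces taking
    roots.\<close>
  also have "(2::real) ^ ?m \<le> (2 ^ ?m) ^ k"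
    using k by (intro self_le_power) auto
  then have "2 ^ ?m * ?P ^ k \<le> (2 ^ ?m * ?P) ^ k"
    using P unfolding power_mult_distrib by (intro mult_right_mono) auto
  finally have "p r ^ k \<le> (2 ^ ?m * ?P) ^ k" .
  then show ?thesis
    using k p_nonneg[of r] r P by (subst (asm) power_mono_iff) auto
qed

lemma integral_\<omega>_pos: "integral {1/2..1} \<omega> > 0"
proof -
  obtain z where z: "z \<in> {1/2..1}" "\<And>x. x \<in> {1/2..1} \<Longrightarrow> \<omega> z \<le> \<omega> x"
    using continuous_attains_inf[of "{1/2..1::real}" \<omega>] \<omega>_cont[of "1/2" 1] by auto
  have "0 < \<omega> z * (1 / 2)" using \<omega>_pos[of z] z by simp
  also have "\<dots> = integral {1/2..1::real} (\<lambda>x. \<omega> z)" by simp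
  also have "\<dots> \<le> integral {1/2..1} \<omega>"
    by (intro integral_le integrable_continuous_interval \<omega>_cont z(2)) auto
  finally show ?thesis .
qed

text \<open>The weight is frozen at 2\<rho>: the increment of \<open>H\<close> over a dyadic
  interval is bounded. One factor 1/r is kept, because sqrt R is controlled only when integrated
  against dr/r.\<close>

lemma outer_weight_le:
  assumes D: "\<And>s. s > 0 \<Longrightarrow> y s \<le> C - s * v' s" and C: "0 \<le> C"
    and r: "\<rho> \<le> r" "r \<le> 2 * \<rho>" and \<rho>: "2 \<le> \<rho>"
  shows "\<omega> r * exp (- 2 * H r) \<le>
    (2 * \<rho>) ^ (n - k) / \<rho> * (2 ^ (n - k) * p (2 * \<rho>)) ^ (k + 1)
      * (exp (2 * (C * ln 2 + (q0 - q))) * exp (- 2 * H (2 * \<rho>))) / r"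
proof -
  have r0: "0 < r" "2 \<le> r" using r \<rho> by auto
  have "H (2 * \<rho>) - H r = integral {r..2 * \<rho>} (\<lambda>s. y s / s)"
    using r r0 by (intro H_diff) auto
  also have "\<dots> \<le> C * ln (2 * \<rho> / r) + 1 * (q0 - q)"
    using r r0 D by (intro integral_div_le continuous_on_subset[OF y_cont]) auto
  also have "ln (2 * \<rho> / r) \<le> ln 2" using r r0 by (simp add: divide_le_eq)
  then have "C * ln (2 * \<rho> / r) \<le> C * ln 2" using C by (intro mult_left_mono)
  finally have "exp (- 2 * H r) \<le> exp (2 * (C * ln 2 + (q0 - q)) + - 2 * H (2 * \<rho>))" by simp
  then have 1: "exp (- 2 * H r) \<le> exp (2 * (C * ln 2 + (q0 - q))) * exp (- 2 * H (2 * \<rho>))"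
    by (simp only: exp_add)
  have "\<rho> * r \<le> r\<^sup>2" using r r0 by (simp add: power2_eq_square mult_right_mono)
  then have 2: "r ^ (n - k) / r\<^sup>2 \<le> (2 * \<rho>) ^ (n - k) / (\<rho> * r)"
    using r r0 \<rho> by (intro frac_le power_mono) auto
  have 3: "p r ^ (k + 1) \<le> (2 ^ (n - k) * p (2 * \<rho>)) ^ (k + 1)"
    using p_doubling[of \<rho> r] r \<rho> p_nonneg[of r] by (intro power_mono) auto
  have "\<omega> r * exp (- 2 * H r) \<le> (2 * \<rho>) ^ (n - k) / (\<rho> * r) * (2 ^ (n - k) * p (2 * \<rho>)) ^ (k + 1)
      * (exp (2 * (C * ln 2 + (q0 - q))) * exp (- 2 * H (2 * \<rho>)))"
    unfolding \<omega>_def using r0 \<rho> p_nonneg[of r] p_nonneg[of "2 * \<rho>"]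
    by (intro mult_mono 1 2 3) auto
  then show ?thesis by (simp add: mult_ac)
qed

lemma p_lower:
  obtains c0 where "c0 > 0" "\<And>r. r \<ge> 4 \<Longrightarrow> c0 * exp (h r) / r \<le> p r"
proof -
  obtain B where B: "B \<ge> 0" "\<And>r. 0 < r \<Longrightarrow> r \<le> 1 \<Longrightarrow> \<omega> r \<le> B" by (rule \<omega>_bound) blast
  obtain C where C: "0 \<le> C" "\<And>s. s > 0 \<Longrightarrow> sqrt (R s) \<le> C - s * v' s"
    "\<And>s. s > 0 \<Longrightarrow> y s \<le> C - s * v' s" by (rule sqrt_R_y_le) blast
  let ?m = "n - k"
  define K1 where "K1 = 64 + 16 * (\<bar>q\<bar> + \<bar>q0\<bar>)"
  \<comment> \<open>The plateau contributes at most -G on [1/2, 1]. This interval lies beyond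
    2\<epsilon> for every \<epsilon> \<le> 1/4, so G can be fixed before \<epsilon>.\<close>
  define G where "G = c1 * integral {1/2..1} \<omega>"
  \<comment> \<open>The inner cutoff then costs at most G/2, independently of \<rho>, and G/2 is
    left for the outer end to compensate; the + 1 covers B = 0.\<close>
  define \<epsilon> where "\<epsilon> = min (1 / 4) (G / (2 * (B * K1 + 1)))"
  define K2 where "K2 = (2 ^ ?m) ^ (k + 1) * exp (2 * (C * ln 2 + (q0 - q)))"
  define K3 where "K3 = (64 + 16 * C) * ln 2 + 16 * (q0 - q)"
  have K1: "K1 > 0" by (simp add: K1_def)
  have K2: "K2 > 0" by (simp add: K2_def)
  have q: "q \<le> q0" using v_ge[of 1] v_le[of 1] by simp
  have K3: "K3 > 0" unfolding K3_def using C q by (intro add_pos_nonneg mult_pos_pos) auto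
  have G: "G > 0" unfolding G_def using c1_pos integral_\<omega>_pos by simp
  have BK: "B * K1 \<ge> 0" using B K1 by simp
  then have "0 < \<epsilon>" using G by (simp add: \<epsilon>_def)
  moreover have "\<epsilon> \<le> 1 / 4" unfolding \<epsilon>_def by (rule min.cobounded1)
  ultimately have \<epsilon>: "0 < \<epsilon>" "\<epsilon> \<le> 1 / 4" .
  have "\<epsilon> * (B * K1) \<le> G / (2 * (B * K1 + 1)) * (B * K1 + 1)"
    using BK \<epsilon> by (intro mult_mono) (auto simp: \<epsilon>_def)
  also have "\<dots> = G / 2"
  proof -
    have half: "G / (2 * x) * x = G / 2" if "x > 0" for x using that by simp
    show ?thesis by (rule half) (use BK in simp)
  qed
  finally have \<epsilon>_small: "B * K1 * \<epsilon> \<le> G / 2" by (simp add: mult.commute)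
  have main: "G / 2 \<le> (2 * \<rho>) ^ ?m / \<rho> * K2 * p (2 * \<rho>) ^ (k + 1) * exp (- 2 * H (2 * \<rho>)) * K3"
    if \<rho>: "\<rho> \<ge> 2" for \<rho>
  proof -
    define j where "j = J (\<eta> \<epsilon> \<rho>) (\<eta>' \<epsilon> \<rho>)"
    define Q where "Q = (2 * \<rho>) ^ ?m / \<rho> * (2 ^ ?m * p (2 * \<rho>)) ^ (k + 1)
      * (exp (2 * (C * ln 2 + (q0 - q))) * exp (- 2 * H (2 * \<rho>)))"
    have Q: "Q \<ge> 0" unfolding Q_def using \<rho> p_nonneg[of "2 * \<rho>"] by simp
    have \<eta>_cont: "continuous_on UNIV (\<eta> \<epsilon> \<rho>)"
      by (intro continuous_at_imp_continuous_on ballI DERIV_isCont[OF \<eta>_D]) (use \<epsilon> \<rho> in auto)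
    have \<eta>'_cont': "continuous_on UNIV (\<eta>' \<epsilon> \<rho>)"
      using \<eta>'_cont \<epsilon> \<rho> by simp
    have j_int: "j integrable_on {a..b}" if "0 < a" for a b
      unfolding j_def by (intro integrable_continuous_interval J_cont \<eta>_cont \<eta>'_cont' that)
    have "0 \<le> integral {\<epsilon>..2 * \<rho>} j"
      unfolding j_def
    proof (rule integral_J_nonneg)
      fix t assume t: "t \<notin> {\<epsilon><..<2 * \<rho>}"
      then consider "t \<le> \<epsilon>" | "2 * \<rho> \<le> t" by force
      then show "\<eta> \<epsilon> \<rho> t = 0"
      proof cases
        case 1
        then have "2 - t / \<epsilon> \<ge> 1" using \<epsilon> by (simp add: divide_le_eq)
        then show ?thesis by (simp add: \<eta>_def cutoff_eq_0)
      next
        case 2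
        then have "t / \<rho> - 1 \<ge> 1" using \<rho> by (simp add: le_divide_eq)
        then show ?thesis by (simp add: \<eta>_def cutoff_eq_0)
      qed
    qed (use \<epsilon> \<rho> \<eta>_D \<eta>'_cont' in auto)
    also have "integral {\<epsilon>..2 * \<rho>} j = integral {\<epsilon>..2 * \<epsilon>} j + (integral {2 * \<epsilon>..1/2} j
        + (integral {1/2..1} j + (integral {1..\<rho>} j + integral {\<rho>..2 * \<rho>} j)))"
      using \<epsilon> \<rho> by (simp add: Henstock_Kurzweil_Integration.integral_combine j_int)
    also have "integral {\<epsilon>..2 * \<epsilon>} j \<le> B * K1 * \<epsilon>"
    proof -
      have "integral {\<epsilon>..2 * \<epsilon>} j \<le> integral {\<epsilon>..2 * \<epsilon>} (\<lambda>r. B * K1)"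
      proof (rule integral_le[OF j_int])
        fix r assume r: "r \<in> {\<epsilon>..2 * \<epsilon>}"
        have "j r \<le> \<omega> r * K1" unfolding j_def K1_def using r \<epsilon> \<rho> by (intro J_inner_le) auto
        also have "\<dots> \<le> B * K1" using r \<epsilon> B(2)[of r] K1 by (intro mult_right_mono) auto
        finally show "j r \<le> B * K1" .
      qed (use \<epsilon> in auto)
      then show ?thesis using \<epsilon> by (simp add: mult_ac)
    qed
    also have "integral {2 * \<epsilon>..1/2} j \<le> 0"
    proof -
      have "integral {2 * \<epsilon>..1/2} j \<le> integral {2 * \<epsilon>..1/2} (\<lambda>r. 0)"
      proof (rule integral_le[OF j_int])
        fix r assume r: "r \<in> {2 * \<epsilon>..1/2}"
        have "j r \<le> - c1 * \<omega> r" unfolding j_def using r \<epsilon> \<rho> by (intro J_plateau) auto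
        also have "\<dots> \<le> 0" using c1_pos \<omega>_pos[of r] r \<epsilon> by simp
        finally show "j r \<le> 0" .
      qed (use \<epsilon> in auto)
      then show ?thesis by simp
    qed
    also have "integral {1/2..1} j \<le> - G"
    proof -
      have "integral {1/2..1} j \<le> integral {1/2..1} (\<lambda>r. - c1 * \<omega> r)"
      proof (rule integral_le[OF j_int])
        show "(\<lambda>r. - c1 * \<omega> r) integrable_on {1/2..1}"
          by (intro integrable_continuous_interval continuous_intros \<omega>_cont) auto
        fix r :: real assume r: "r \<in> {1/2..1}"
        show "j r \<le> - c1 * \<omega> r" unfolding j_def using r \<epsilon> \<rho> by (intro J_plateau) auto
      qed auto
      then show ?thesis by (simp add: G_def)
    qed
    also have "integral {1..\<rho>} j \<le> 0"
    proof -
      have "integral {1..\<rho>} j \<le> integral {1..\<rho>} (\<lambda>r. 0)"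
        unfolding j_def[symmetric] using j_int J_middle \<epsilon> unfolding j_def by (intro integral_le) auto
      then show ?thesis by simp
    qed
    also have "integral {\<rho>..2 * \<rho>} j \<le> Q * K3"
    proof -
      let ?F = "\<lambda>r. (64 + 16 * sqrt (R r)) / r"
      have F_cont: "continuous_on {\<rho>..2 * \<rho>} (\<lambda>r. 64 + 16 * sqrt (R r))"
        using \<rho> by (intro continuous_intros continuous_on_subset[OF R_cont]) auto
      have F_int: "?F integrable_on {\<rho>..2 * \<rho>}"
        using \<rho> by (intro integrable_continuous_interval continuous_on_divide F_cont continuous_intros) auto
      have "integral {\<rho>..2 * \<rho>} j \<le> integral {\<rho>..2 * \<rho>} (\<lambda>r. Q * ?F r)"
      proof (rule integral_le[OF j_int])
        show "(\<lambda>r. Q * ?F r) integrable_on {\<rho>..2 * \<rho>}"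
          using F_int by (rule integrable_on_mult_right)
        fix r assume r: "r \<in> {\<rho>..2 * \<rho>}"
        have "j r \<le> \<omega> r * exp (- 2 * H r) * (64 + 16 * sqrt (R r))"
          unfolding j_def using r \<epsilon> \<rho> by (intro J_outer) auto
        also have "\<dots> \<le> Q / r * (64 + 16 * sqrt (R r))"
          unfolding Q_def using r \<rho> C R_pos[of r]
          by (intro mult_right_mono outer_weight_le) (auto intro: add_nonneg_nonneg)
        finally show "j r \<le> Q * ?F r" by simp
      qed (use \<rho> in auto)
      also have "\<dots> = Q * integral {\<rho>..2 * \<rho>} ?F" by (rule integral_mult_right)
      also have "integral {\<rho>..2 * \<rho>} ?F \<le> (64 + 16 * C) * ln (2 * \<rho> / \<rho>) + 16 * (q0 - q)"
      proof (rule integral_div_le[OF _ _ F_cont])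
        fix s assume "s \<in> {\<rho>..2 * \<rho>}"
        then have "sqrt (R s) \<le> C - s * v' s" using C(2)[of s] \<rho> by simp
        then show "64 + 16 * sqrt (R s) \<le> 64 + 16 * C - 16 * (s * v' s)" by simp
      qed (use \<rho> in auto)
      then have "Q * integral {\<rho>..2 * \<rho>} ?F \<le> Q * K3"
        using Q \<rho> by (intro mult_left_mono) (auto simp: K3_def)
      finally show ?thesis .
    qed
    finally have "G / 2 \<le> Q * K3" using \<epsilon>_small by simp
    then show ?thesis unfolding Q_def K2_def by (simp add: power_mult_distrib mult_ac)
  qed
  \<comment> \<open>\<open>main\<close> at \<rho> = r/2, solved for p^(k+1): the 4 collects G/2 and
    1/(r/2), and the exponential is the price of replacing \<open>H\<close> by
    \<open>E\<close>.\<close>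
  define c2 where "c2 = G * exp (2 * (H 2 - E 2)) / (4 * K2 * K3)"
  \<comment> \<open>The minimum with 1 gives c0^(k+1) \<le> c0 \<le> c2, which avoids a (k+1)-st
    root.\<close>
  define c0 where "c0 = min c2 1"
  have c2: "c2 > 0" unfolding c2_def using G K2 K3 by simp
  show thesis
  proof (rule that[of c0])
    show c0: "c0 > 0" using c2 by (simp add: c0_def)
    fix r :: real assume r: "r \<ge> 4"
    have "G / 2 \<le> r ^ ?m / (r / 2) * K2 * p r ^ (k + 1) * exp (- 2 * H r) * K3"
      using main[of "r / 2"] r by simp
    also have "exp (- 2 * H r) = exp (- (2 * E r)) * exp (- (2 * (H 2 - E 2)))"
      using H_eq_E[of r] r by (simp flip: exp_add)
    finally have "c2 * (exp (2 * E r) * r / r ^ ?m) \<le> p r ^ (k + 1)"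
      using r K2 K3 unfolding c2_def exp_minus by (simp add: field_simps)
    \<comment> \<open>The formula for \<delta> comes from this balance: (k+1)(h - ln r) = 2E + (1 -
      (n - k)) ln r.\<close>
    moreover have "exp (2 * E r) * r / r ^ ?m = (exp (h r) / r) ^ (k + 1)"
    proof -
      have "(exp (h r) / r) ^ (k + 1) = exp ((real k + 1) * h r) / exp (real (k + 1) * ln r)"
        using r by (simp only: power_divide power_eq_exp_ln exp_of_nat_mult[symmetric]) (simp add: add.commute)
      also have "(real k + 1) * h r = (- real n + 2 * real k + 2) * ln r + 2 * E r"
        by (simp add: h_def)
      also have "exp ((- real n + 2 * real k + 2) * ln r + 2 * E r) / exp (real (k + 1) * ln r) =
          exp (2 * E r + ln r - real ?m * ln r)"
        unfolding exp_diff[symmetric] by (simp add: real_nk algebra_simps)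
      also have "\<dots> = exp (2 * E r) * r / r ^ ?m"
        using r by (simp add: exp_diff exp_add power_eq_exp_ln)
      finally show ?thesis by simp
    qed
    moreover have "c0 ^ (k + 1) * (exp (h r) / r) ^ (k + 1) \<le> c2 * (exp (h r) / r) ^ (k + 1)"
    proof (rule mult_right_mono)
      have "c0 ^ (k + 1) \<le> c0 ^ 1" using c0 by (intro power_decreasing) (auto simp: c0_def)
      then show "c0 ^ (k + 1) \<le> c2" by (simp add: c0_def)
    qed (use r in simp)
    ultimately have "(c0 * (exp (h r) / r)) ^ (k + 1) \<le> p r ^ (k + 1)"
      unfolding power_mult_distrib by simp
    then have "c0 * (exp (h r) / r) \<le> p r"
      using p_nonneg[of r] r c0 by (subst (asm) power_mono_iff) auto
    then show "c0 * exp (h r) / r \<le> p r" by simp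
  qed
qed

text \<open>For \<kappa> > 0 the lower bound on p drives U to infinity; for \<kappa> < 0 U may
  converge and the increment U(2r) - U(r) is what counts; for \<kappa> = 0 \<open>h_ge\<close>
  leaves p \<ge> c0/r, whose integral is the logarithm.\<close>

lemma abs_U_lower:
  "\<exists>M>0. \<exists>r0\<ge>1. \<forall>r\<ge>r0. M * (if real n \<noteq> 2 * (real k + 2 * \<gamma> / real k + 4) then exp (h r) else ln r) \<le> \<bar>U r\<bar>"
proof -
  obtain c0 where c0: "c0 > 0" "\<And>r. r \<ge> 4 \<Longrightarrow> c0 * exp (h r) / r \<le> p r" by (rule p_lower) blast
  obtain D where D: "\<And>a s t. 1 \<le> a \<Longrightarrow> s \<in> {a..2*a} \<Longrightarrow> t \<in> {a..2*a} \<Longrightarrow> \<bar>h s - h t\<bar> \<le> D"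
    by (rule h_oscillation) blast
  have osc: "\<bar>h s - h t\<bar> \<le> D" if "4 \<le> a" "s \<in> {a..2*a}" "t \<in> {a..2*a}" for a s t
    using D[of a s t] that by simp
  consider "\<kappa> > 0" | "\<kappa> < 0" | "\<kappa> = 0" by linarith
  then show ?thesis
  proof cases
    case 1
    obtain M r1 where "M > 0" "r1 \<ge> 1" "\<And>r. r \<ge> r1 \<Longrightarrow> M * exp (h r) \<le> \<bar>U r\<bar>"
      by (rule abs_ge_of_derivative_at_top[OF U_D p_nonneg c0(2,1) _ osc h_at_top[OF 1]]) (simp; fail | blast)+
    with 1 show ?thesis unfolding \<kappa>_eq_0_iff[symmetric] by auto
  next
    case 2
    obtain M r1 where "M > 0" "r1 \<ge> 1" "\<And>r. r \<ge> r1 \<Longrightarrow> M * exp (h r) \<le> \<bar>U r\<bar>"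
      by (rule abs_ge_of_derivative_at_bot[OF U_D p_nonneg c0(2,1) _ osc h_at_bot[OF 2]]) (simp; fail | blast)+
    with 2 show ?thesis unfolding \<kappa>_eq_0_iff[symmetric] by auto
  next
    case 3
    have low: "c0 / r \<le> p r" if "r \<ge> 4" for r
    proof -
      have "c0 * 1 / r \<le> c0 * exp (h r) / r"
        using h_ge[of r] 3 that c0(1) by (intro divide_right_mono mult_left_mono) auto
      then show ?thesis using c0(2)[OF that] by simp
    qed
    obtain r1 where "r1 \<ge> 1" "\<And>r. r \<ge> r1 \<Longrightarrow> c0 / 2 * ln r \<le> \<bar>U r\<bar>"
      by (rule abs_ge_ln_of_derivative[OF U_D low c0(1)]) (simp; fail | blast)+
    then show ?thesis using 3 c0(1) unfolding \<kappa>_eq_0_iff[symmetric]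
      by (intro exI[of _ "c0 / 2"]) auto
  qed
qed

end

section \<open>Lower bound for 2k + \<gamma> < 0\<close>

locale subcritical_sol = radial_sol + subcritical_weight
begin

text \<open>From A r \<ge> A 1 > 0 one gets p^k \<ge> A 1 / r^(n-k). The root of A 1 is replaced by
  min (A 1) 1, whose k-th power does not exceed A 1.\<close>

lemma p_lower_subcritical:
  obtains c0 where "c0 > 0" "\<And>r. r \<ge> 1 \<Longrightarrow> c0 * exp ((2 - real n / real k) * ln r) / r \<le> p r"
proof (rule that[of "min (A 1) 1"])
  have A1: "A 1 > 0" using p_pos[of 1] by (simp add: A_def)
  then show "min (A 1) 1 > 0" by simp
  fix r :: real assume r: "r \<ge> 1"
  let ?c = "min (A 1) 1" and ?x = "exp ((2 - real n / real k) * ln r) / r"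
  have "?x ^ k = exp (real k * ((2 - real n / real k) * ln r)) / exp (real k * ln r)"
    using r by (simp only: power_divide power_eq_exp_ln exp_of_nat_mult[symmetric])
  also have "\<dots> = exp (- (real (n - k) * ln r))"
    unfolding exp_diff[symmetric] using k_pos by (simp add: real_nk algebra_simps)
  also have "\<dots> = 1 / r ^ (n - k)"
    using r by (simp add: exp_minus power_eq_exp_ln inverse_eq_divide)
  finally have x: "?x ^ k = 1 / r ^ (n - k)" .
  have "?c ^ k \<le> ?c ^ 1" using A1 k by (intro power_decreasing) auto
  then have "?c ^ k \<le> A r" using A_mono[of 1 r] r by simp
  then have "?c ^ k * ?x ^ k \<le> A r * (1 / r ^ (n - k))"
    unfolding x using r by (intro mult_right_mono) auto
  also have "\<dots> = p r ^ k" using r by (simp add: A_def)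
  finally have "(?c * ?x) ^ k \<le> p r ^ k" unfolding power_mult_distrib .
  then show "?c * exp ((2 - real n / real k) * ln r) / r \<le> p r"
    using k p_nonneg[of r] r A1 by (subst (asm) power_mono_iff) auto
qed

lemma abs_U_lower:
  "\<exists>M>0. \<exists>r0\<ge>1. \<forall>r\<ge>r0. M * (if real n \<noteq> 2 * (real k + 2 * \<gamma> / real k + 4) then exp (h r) else ln r) \<le> \<bar>U r\<bar>"
proof -
  define a where "a = 2 - real n / real k"
  obtain c0 where c0: "c0 > 0" "\<And>r. r \<ge> 1 \<Longrightarrow> c0 * exp (a * ln r) / r \<le> p r"
    unfolding a_def by (rule p_lower_subcritical) blast
  obtain r1 B where r1: "1 \<le> r1" "\<And>r. r \<ge> r1 \<Longrightarrow> h r \<le> a * ln r + B"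
    unfolding a_def by (rule h_le_subcritical) blast
  have exp_h: "exp (- B) * exp (h r) \<le> exp (a * ln r)" if "r \<ge> r1" for r
    using r1(2)[OF that] by (simp flip: exp_add)
  have osc: "\<bar>a * ln s - a * ln t\<bar> \<le> \<bar>a\<bar> * ln 2" if "1 \<le> b" "s \<in> {b..2*b}" "t \<in> {b..2*b}" for b s t
  proof -
    have "\<bar>ln s - ln t\<bar> \<le> ln 2"
    proof -
      have "ln s \<le> ln (2 * t)" "ln t \<le> ln (2 * s)" using that by auto
      then show ?thesis using that by (simp add: ln_mult)
    qed
    then show ?thesis by (simp add: abs_mult mult_left_mono flip: right_diff_distrib)
  qed
  \<comment> \<open>The exceptional dimension 2(k + 2\<gamma>/k + 4) is thus smaller than 2k and can
    occur only for a > 0, where the power r^a dominates the required logarithm.\<close>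
  have \<gamma>k: "2 * \<gamma> / real k < - 4" using subcritical k_pos by (simp add: divide_less_eq)
  consider "a > 0" | "a < 0" | "a = 0" by linarith
  then show ?thesis
  proof cases
    case 1
    then have lim: "filterlim (\<lambda>r. a * ln r) at_top at_top"
      by (intro filterlim_tendsto_pos_mult_at_top[OF tendsto_const _ ln_at_top])
    obtain M r2 where M: "M > 0" "r2 \<ge> 1" "\<And>r. r \<ge> r2 \<Longrightarrow> M * exp (a * ln r) \<le> \<bar>U r\<bar>"
      by (rule abs_ge_of_derivative_at_top[OF U_D p_nonneg c0(2,1) _ osc lim]) (simp; fail | blast)+
    show ?thesis
    proof (cases "real n = 2 * (real k + 2 * \<gamma> / real k + 4)")
      case True
      have "M * a * ln r \<le> \<bar>U r\<bar>" if "r \<ge> r2" for r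
      proof -
        have "a * ln r \<le> exp (a * ln r)" using exp_ge_add_one_self[of "a * ln r"] by linarith
        then have "M * (a * ln r) \<le> M * exp (a * ln r)" using M(1) by simp
        then show ?thesis using M(3)[OF that] by simp
      qed
      with True M 1 show ?thesis by (intro exI[of _ "M * a"]) auto
    next
      case False
      have "M * exp (- B) * exp (h r) \<le> \<bar>U r\<bar>" if "r \<ge> max r1 r2" for r
        using order_trans[OF mult_left_mono[OF exp_h[of r], of M] M(3)[of r]] M(1) that by (simp add: mult.assoc)
      with False M r1(1) show ?thesis by (intro exI[of _ "M * exp (- B)"] conjI exI[of _ "max r1 r2"]) auto
    qed
  next
    case 2
    then have lim: "filterlim (\<lambda>r. a * ln r) at_bot at_top"
      by (intro filterlim_tendsto_neg_mult_at_bot[OF tendsto_const _ ln_at_top])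
    obtain M r2 where M: "M > 0" "r2 \<ge> 1" "\<And>r. r \<ge> r2 \<Longrightarrow> M * exp (a * ln r) \<le> \<bar>U r\<bar>"
      by (rule abs_ge_of_derivative_at_bot[OF U_D p_nonneg c0(2,1) _ osc lim]) (simp; fail | blast)+
    have "real n > 2 * real k" using 2 k_pos by (simp add: a_def less_divide_eq)
    then have "real n \<noteq> 2 * (real k + 2 * \<gamma> / real k + 4)" using \<gamma>k by simp
    moreover have "M * exp (- B) * exp (h r) \<le> \<bar>U r\<bar>" if "r \<ge> max r1 r2" for r
      using order_trans[OF mult_left_mono[OF exp_h[of r], of M] M(3)[of r]] M(1) that by (simp add: mult.assoc)
    ultimately show ?thesis using M r1(1)
      by (intro exI[of _ "M * exp (- B)"] conjI exI[of _ "max r1 r2"]) auto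
  next
    case 3
    have low: "c0 / r \<le> p r" if "r \<ge> 1" for r using c0(2)[OF that] 3 by simp
    obtain r2 where r2: "r2 \<ge> 1" "\<And>r. r \<ge> r2 \<Longrightarrow> c0 / 2 * ln r \<le> \<bar>U r\<bar>"
      by (rule abs_ge_ln_of_derivative[OF U_D low c0(1)]) (simp; fail | blast)+
    have "real n = 2 * real k" using 3 k_pos by (simp add: a_def field_simps)
    then have "real n \<noteq> 2 * (real k + 2 * \<gamma> / real k + 4)" using \<gamma>k by simp
    moreover have "c0 / 2 * exp (- B) * exp (h r) \<le> \<bar>U r\<bar>" if "r \<ge> max (exp 1) (max r1 r2)" for r
    proof -
      \<comment> \<open>For a = 0 the function r^\<delta> is merely bounded by exp B, so a
        logarithmic lower bound suffices as soon as ln r \<ge> 1.\<close>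
      have "exp (- B) * exp (h r) \<le> 1" using exp_h[of r] that 3 by simp
      also have "1 \<le> ln r" using that r1(1) by (subst ln_ge_iff) auto
      finally have "c0 / 2 * (exp (- B) * exp (h r)) \<le> c0 / 2 * ln r"
        using c0(1) by (intro mult_left_mono) auto
      then show ?thesis using r2(2)[of r] that by simp
    qed
    ultimately show ?thesis using c0(1) r1(1)
      by (intro exI[of _ "c0 / 2 * exp (- B)"] conjI exI[of _ "max (exp 1) (max r1 r2)"]) auto
  qed
qed

end

section \<open>Reduction to the radial problem\<close>

text \<open>S_1 is the Laplacian, and r^(n-1) times it is the derivative of r^(n-1) p; this product
  is nondecreasing and starts from 0.\<close>

lemma radial_derivative_nonneg:
  fixes u :: "real^'n \<Rightarrow> real"
  assumes u: "\<And>x. u x = U (norm x)" and U: "\<And>t. (U has_real_derivative p t) (at t)"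
    and p: "\<And>t. (p has_real_derivative p' t) (at t)" and p0: "p 0 = 0"
    and S1: "\<And>x. hessian_op 1 u x \<ge> 0" and t: "t \<ge> 0"
  shows "p t \<ge> 0"
proof (cases "t = 0")
  case False
  define m where "m = CARD('n) - 1"
  \<comment> \<open>In dimension one 0 ^ m is 1, so the left-hand side vanishes because p 0 =
    0.\<close>
  have "0 ^ m * p 0 \<le> t ^ m * p t"
  proof (rule DERIV_nonneg_imp_increasing_open[where f = "\<lambda>s. s ^ m * p s"])
    fix s :: real assume s: "0 < s" "s < t"
    have m': "real m * s ^ (m - 1) = real m * s ^ m / s" using s by (cases m) auto
    have "((\<lambda>s. s ^ m * p s) has_real_derivative real m * s ^ (m - 1) * p s + p' s * s ^ m) (at s)"
      by (auto intro!: derivative_eq_intros p)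
    moreover have "real m * s ^ (m - 1) * p s + p' s * s ^ m = s ^ m * (p' s + real m * (p s / s))"
      unfolding m' by (simp add: algebra_simps)
    moreover have "p' s + real m * (p s / s) \<ge> 0"
      using S1[of "s *\<^sub>R axis undefined 1"] hessian_op_radial[OF u U p, of 1 s undefined, folded m_def] s
      by simp
    ultimately show "\<exists>y. ((\<lambda>s. s ^ m * p s) has_real_derivative y) (at s) \<and> 0 \<le> y"
      using s by (metis mult_nonneg_nonneg zero_le_power less_imp_le)
  next
    have "continuous_on {0..t} p"
      by (intro continuous_at_imp_continuous_on ballI DERIV_isCont[OF p])
    then show "continuous_on {0..t} (\<lambda>s. s ^ m * p s)" by (intro continuous_intros)
  qed (use t False in auto)
  then have "0 \<le> t ^ m * p t" by (simp add: p0)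
  moreover have "0 < t ^ m" using t False by simp
  ultimately show ?thesis by (simp only: zero_le_mult_iff) auto
qed (use p0 in simp)

text \<open>The binomials (n-1 choose k-1) and (n-1 choose k) equal k c_{n,k} and (n-k) c_{n,k}.
  With the common factor taken out, multiplication by r^(n-1) brings the equation into divergence
  form.\<close>

lemma radial_hessian_equation:
  fixes u :: "real^'n \<Rightarrow> real"
  assumes u: "\<And>x. u x = U (norm x)" and U: "\<And>t. (U has_real_derivative p t) (at t)"
    and p: "\<And>t. (p has_real_derivative p' t) (at t)" and k: "1 \<le> k" "k \<le> CARD('n)"
    and eq: "\<And>x. x \<noteq> 0 \<Longrightarrow> hessian_op k u x = w (norm x) * g (u x)" and r: "r > 0"
  shows "binomial_const CARD('n) k * (r ^ (CARD('n) - k) * p r ^ (k - 1) *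
      (real (CARD('n) - k) * p r / r + real k * p' r)) = r ^ (CARD('n) - 1) * w r * g (U r)"
proof -
  let ?n = "CARD('n)" and ?x = "r *\<^sub>R axis undefined 1 :: real^'n"
  have x: "norm ?x = r" "?x \<noteq> 0" using r by (auto simp: axis_eq_0_iff)
  have "real k * real (?n choose k) = real ?n * real (?n - 1 choose (k - 1))"
    using times_binomial_minus1_eq[of k ?n] k by (metis of_nat_mult less_le_trans zero_less_one)
  then have c1: "real (?n - 1 choose (k - 1)) = binomial_const ?n k * real k"
    by (simp add: binomial_const_def field_simps)
  have "real (?n - k) * real (?n choose k) = real ?n * real (?n - 1 choose k)"
    using binomial_absorb_comp[of ?n k] by (metis of_nat_mult)
  then have c2: "real (?n - 1 choose k) = binomial_const ?n k * real (?n - k)"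
    by (simp add: binomial_const_def field_simps)
  have "w r * g (U r) = hessian_op k u ?x" using eq[OF x(2)] u[of ?x] x(1) by simp
  also have "\<dots> = binomial_const ?n k * ((p r / r) ^ (k - 1) * (real (?n - k) * p r / r + real k * p' r))"
    unfolding hessian_op_radial[OF u U p k(1) r] c1 c2
  proof -
    define d where "d = real (?n - k)"
    have "(p r / r) ^ k = (p r / r) ^ (k - 1) * (p r / r)" using k by (cases k) auto
    then show "binomial_const ?n k * real k * p' r * (p r / r) ^ (k - 1) + binomial_const ?n k * real (?n - k) * (p r / r) ^ k =
        binomial_const ?n k * ((p r / r) ^ (k - 1) * (real (?n - k) * p r / r + real k * p' r))"
      unfolding d_def[symmetric] by (simp add: algebra_simps)
  qed
  finally have "r ^ (?n - 1) * (w r * g (U r)) =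
      binomial_const ?n k * ((r ^ (?n - 1) * (p r / r) ^ (k - 1)) * (real (?n - k) * p r / r + real k * p' r))"
    by simp
  also have "r ^ (?n - 1) = r ^ (?n - k) * r ^ (k - 1)" using k by (simp flip: power_add)
  then have "r ^ (?n - 1) * (p r / r) ^ (k - 1) = r ^ (?n - k) * p r ^ (k - 1)"
    using r by (simp add: power_divide)
  finally show ?thesis by (simp add: mult_ac)
qed

text \<open>In polar coordinates r^(n-1) r^(1-k) = r^(n-k), and the positive area of the unit sphere
  is divided out.\<close>

lemma semi_stable_radial:
  fixes u :: "real^'n \<Rightarrow> real"
  assumes u: "\<And>x. u x = U (norm x)" and U: "\<And>t. (U has_real_derivative p t) (at t)"
    and p: "continuous_on UNIV p" "\<And>t. t \<ge> 0 \<Longrightarrow> p t \<ge> 0"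
    and k: "1 \<le> k" "k \<le> CARD('n)" and w: "continuous_on {0<..} w" and g: "continuous_on UNIV (deriv g)"
    and stable: "semi_stable k w g u"
    and a: "0 < a" and \<psi>: "\<And>t. (\<psi> has_real_derivative \<psi>' t) (at t)"
    and \<psi>': "continuous_on UNIV \<psi>'" and supp: "\<And>t. t \<notin> {a<..<b} \<Longrightarrow> \<psi> t = 0"
  shows "0 \<le> integral {a..b} (\<lambda>r. binomial_const CARD('n) k * real k * r ^ (CARD('n) - k) * p r ^ (k - 1) * (\<psi>' r)\<^sup>2
                             + r ^ (CARD('n) - 1) * w r * deriv g (U r) * (\<psi> r)\<^sup>2)"
proof -
  let ?n = "CARD('n)" and ?\<xi> = "\<lambda>x::real^'n. \<psi> (norm x)"
  define F where "F r = real k * binomial_const ?n k * (1 / r ^ (k - 1)) * p r ^ (k - 1) * (\<psi>' r)\<^sup>2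
      + w r * deriv g (U r) * (\<psi> r)\<^sup>2" for r
  have supp': "\<psi> t = 0" if "t \<notin> {a..b}" for t
    using supp[of t] that by auto
  have \<psi>'_0: "\<psi>' t = 0" if "t \<notin> {a..b}" for t
  proof (rule DERIV_unique[OF \<psi>])
    show "(\<psi> has_real_derivative 0) (at t)"
      by (rule has_field_derivative_transform_within_open[of "\<lambda>_. 0" _ _ "- {a..b}"]) (use that supp' in auto)
  qed
  have test: "C1_on UNIV ?\<xi>" "compact (closure {x. ?\<xi> x \<noteq> 0})" "radially_symmetric ?\<xi>"
    "gradient ?\<xi> 0 = 0"
    by (rule radial_test_function[OF a \<psi> \<psi>', of b]; simp add: supp')+
  have grad_norm: "norm (gradient ?\<xi> x) = \<bar>\<psi>' (norm x)\<bar>" if "x \<noteq> 0" for x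
    by (rule radial_test_function(4)[OF a \<psi> \<psi>', of b]) (use supp' that in auto)
  have F: "stability_integrand k w g u ?\<xi> x = F (norm x)" for x
  \<comment> \<open>At the origin both sides are 0: the test function vanishes near it, so the value
    assigned to 0 raised to a negative power is multiplied by a zero gradient.\<close>
  proof (cases "x = 0")
    case True
    then show ?thesis
      using test(4) \<psi>'_0[of 0] supp[of 0] a by (simp add: stability_integrand_def F_def)
  next
    case False
    have "gradient u x = (p (norm x) / norm x) *\<^sub>R x"
    proof -
      have "u = (\<lambda>x. U (norm x))" using u by auto
      then show ?thesis using gradient_eqI[OF has_derivative_radial[OF False U]] by simp
    qed
    then have "norm (gradient u x) = p (norm x)" using False p(2)[of "norm x"] by simp
    moreover have "norm x powi (1 - int k) = 1 / norm x ^ (k - 1)"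
    proof -
      have "1 - int k = - int (k - 1)" using k by simp
      then show ?thesis by (simp only: power_int_minus power_int_of_nat inverse_eq_divide)
    qed
    ultimately show ?thesis
      unfolding stability_integrand_def F_def grad_norm[OF False] u by simp
  qed
  have "0 \<le> (LINT x|lborel. stability_integrand k w g u ?\<xi> x)"
    using stable test unfolding semi_stable_def by blast
  also have "\<dots> = (LINT x|lborel. F (norm (x::real^'n)))" unfolding F ..
  also have "\<dots> = real ?n * unit_ball_vol (real ?n) * integral {a..b} (\<lambda>r. r ^ (?n - 1) * F r)"
  proof -
    have "continuous_on {a..b} (\<lambda>r. deriv g (U r))" "continuous_on {a..b} \<psi>"
      by (intro continuous_on_compose2[OF g] continuous_at_imp_continuous_on ballI DERIV_isCont[OF U]
          DERIV_isCont[OF \<psi>]; simp)+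
    then have "continuous_on {a..b} F"
      unfolding F_def[abs_def] using a
      by (intro continuous_intros continuous_on_subset[OF p(1)] continuous_on_subset[OF \<psi>']
          continuous_on_subset[OF w]) auto
    then show ?thesis
      using integral_norm_lborel[OF a, where 'a = "real^'n" and F = F and b = b] \<psi>'_0 supp'
      by (simp add: F_def)
  qed
  finally have "0 \<le> integral {a..b} (\<lambda>r. r ^ (?n - 1) * F r)"
  proof -
    have "0 < real ?n * unit_ball_vol (real ?n)" by (intro mult_pos_pos unit_ball_vol_pos) auto
    moreover assume "0 \<le> real ?n * unit_ball_vol (real ?n) * integral {a..b} (\<lambda>r. r ^ (?n - 1) * F r)"
    ultimately show ?thesis
      using mult_le_cancel_left_pos[of "real ?n * unit_ball_vol (real ?n)" 0] by simp
  qed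
  also have "\<dots> = integral {a..b} (\<lambda>r. binomial_const ?n k * real k * r ^ (?n - k) * p r ^ (k - 1) * (\<psi>' r)\<^sup>2
      + r ^ (?n - 1) * w r * deriv g (U r) * (\<psi> r)\<^sup>2)"
  proof (rule Henstock_Kurzweil_Integration.integral_cong)
    fix r assume "r \<in> {a..b}"
    then have "r > 0" using a by simp
    moreover have "r ^ (?n - 1) = r ^ (?n - k) * r ^ (k - 1)" using k by (simp flip: power_add)
    ultimately have weight: "r ^ (?n - 1) * (1 / r ^ (k - 1)) = r ^ (?n - k)" by simp
    have "r ^ (?n - 1) * F r = binomial_const ?n k * real k * (r ^ (?n - 1) * (1 / r ^ (k - 1)))
        * p r ^ (k - 1) * (\<psi>' r)\<^sup>2 + r ^ (?n - 1) * w r * deriv g (U r) * (\<psi> r)\<^sup>2"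
      unfolding F_def by (simp only: distrib_left mult_ac)
    then show "r ^ (?n - 1) * F r = binomial_const ?n k * real k * r ^ (?n - k) * p r ^ (k - 1) * (\<psi>' r)\<^sup>2
      + r ^ (?n - 1) * w r * deriv g (U r) * (\<psi> r)\<^sup>2"
      unfolding weight .
  qed
  finally show ?thesis .
qed

text \<open>Strict positivity of w gives W = r w'/w a meaning. \<open>dim_meaningful\<close>
  excludes a zero denominator, and \<open>alpha_meaningful\<close> makes the square root in \<alpha>
  that of a nonnegative number.\<close>

theorem theorem1p3:
  fixes k :: nat and g w :: "real \<Rightarrow> real" and \<Gamma> \<gamma> :: real and u :: "real^'n \<Rightarrow> real"
  assumes k: "k \<in> {1..CARD('n)}"
    and g_C1: "\<And>t. g differentiable (at t)" "continuous_on UNIV (deriv g)"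
    and g_nonneg: "\<And>t. g t \<ge> 0"
    and g_antimono: "antimono g"
    and w_pos: "\<And>r. r > 0 \<Longrightarrow> w r > 0"
    and w_C1: "C1_on (- {0}) (\<lambda>x::real^'n. w (norm x))"
    and W_C1: "C1_on (- {0}) (\<lambda>x::real^'n. log_slope w (norm x))"
    and W_antimono: "antimono_on {0<..} (log_slope w)"
    and W_0: "(log_slope w \<longlongrightarrow> \<Gamma>) (at_right 0)"
    and W_infinity: "(log_slope w \<longlongrightarrow> \<gamma>) at_top"
    and dim_meaningful: "2 * real k + \<gamma> \<noteq> 0"
    and dim: "real CARD('n) > real k * (real k + 1) / (2 * real k + \<gamma>)"
    and alpha_meaningful: "\<And>s. s \<ge> 1 \<Longrightarrow> radicand CARD('n) k w s \<ge> 0"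
    and sol: "radial_solution k w g u"
    and stable: "semi_stable k w g u"
    and nonconst: "\<not> u constant_on UNIV"
  shows "\<exists>M>0. \<exists>r0\<ge>1. \<forall>r\<ge>r0. \<forall>x. norm x = r \<longrightarrow>
           \<bar>u x\<bar> \<ge> M * (if real CARD('n) \<noteq> 2 * (real k + 2 * \<gamma> / real k + 4)
                        then r powr delta CARD('n) k w r else ln r)"
proof -
  have k': "1 \<le> k" "k \<le> CARD('n)" using k by auto
  have C2: "C2 u" and rad: "radially_symmetric u" and S1: "\<And>x. hessian_op 1 u x \<ge> 0"
    and eq: "\<And>x. x \<noteq> 0 \<Longrightarrow> hessian_op k u x = w (norm x) * g (u x)"
    using sol k unfolding radial_solution_def k_admissible_def by auto
  obtain U p p' where u: "\<And>x. u x = U (norm x)" and U: "\<And>t. (U has_real_derivative p t) (at t)"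
    and p: "\<And>t. (p has_real_derivative p' t) (at t)" and p': "continuous_on UNIV p'" and p0: "p 0 = 0"
    by (rule C2_radial_profile[OF C2 rad]) blast
  have p_nonneg: "p t \<ge> 0" if "t \<ge> 0" for t
    by (rule radial_derivative_nonneg[OF u U p p0 S1 that])
  have p_cont: "continuous_on UNIV p"
    by (intro continuous_at_imp_continuous_on ballI DERIV_isCont[OF p])
  note w_D = radial_C1_profile(1)[OF w_C1]
  have w_cont: "continuous_on {0<..} w"
    by (auto intro!: continuous_at_imp_continuous_on DERIV_isCont[OF w_D])
  have nontrivial: "\<exists>t>0. p t \<noteq> 0"
  proof (rule ccontr)
    assume "\<not> ?thesis"
    then have p_0: "p t = 0" if "t > 0" for t using that by auto
    have U_const: "U t = U 0" if t: "t \<ge> 0" for t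
    proof (cases "t = 0")
      case False
      show ?thesis
      proof (rule DERIV_isconst_end[where f = U])
        show "continuous_on {0..t} U"
          by (intro continuous_at_imp_continuous_on ballI DERIV_isCont[OF U])
        fix x :: real assume "0 < x"
        then show "(U has_real_derivative 0) (at x)" using U[of x] p_0 by simp
      qed (use t False in simp)
    qed simp
    have "u x = U 0" for x unfolding u by (rule U_const) simp
    then show False using nonconst by (auto simp: constant_on_def)
  qed
  have weight: "weight CARD('n) k w \<Gamma> \<gamma>"
    by unfold_locales
       (use k' w_pos w_D radial_C1_profile[OF W_C1] W_antimono W_0 W_infinity dim alpha_meaningful in auto)
  have "radial_sol_axioms CARD('n) k w g U p p' (binomial_const CARD('n) k)"
  proof
    show "binomial_const CARD('n) k > 0" using k' by (simp add: binomial_const_def)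
    show "(g has_real_derivative deriv g t) (at t)" for t
      using g_C1(1) by (simp add: DERIV_deriv_iff_real_differentiable)
  qed (use g_C1 g_nonneg g_antimono U p p' p0 p_nonneg nontrivial radial_hessian_equation[OF u U p k' eq]
      semi_stable_radial[OF u U p_cont p_nonneg k' w_cont g_C1(2) stable] in auto)
  with weight have sol: "radial_sol CARD('n) k w \<Gamma> \<gamma> g U p p' (binomial_const CARD('n) k)"
    by (rule radial_sol.intro)
  let ?h = "weight.h CARD('n) k w"
  have "\<exists>M>0. \<exists>r0\<ge>1. \<forall>r\<ge>r0. M * (if real CARD('n) \<noteq> 2 * (real k + 2 * \<gamma> / real k + 4)
      then exp (?h r) else ln r) \<le> \<bar>U r\<bar>"
  proof (cases "2 * real k + \<gamma> > 0")
    case True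
    then have "supercritical_sol CARD('n) k w \<Gamma> \<gamma> g U p p' (binomial_const CARD('n) k)"
      using sol weight by (simp add: supercritical_sol_def supercritical_weight_def supercritical_weight_axioms_def)
    then show ?thesis by (rule supercritical_sol.abs_U_lower)
  next
    case False
    then have "subcritical_sol CARD('n) k w \<Gamma> \<gamma> g U p p' (binomial_const CARD('n) k)"
      using sol weight dim_meaningful
      by (simp add: subcritical_sol_def subcritical_weight_def subcritical_weight_axioms_def)
    then show ?thesis by (rule subcritical_sol.abs_U_lower)
  qed
  then obtain M r0 where "M > 0" and lower: "\<And>r. r \<ge> r0 \<Longrightarrow>
      M * (if real CARD('n) \<noteq> 2 * (real k + 2 * \<gamma> / real k + 4) then exp (?h r) else ln r) \<le> \<bar>U r\<bar>"
    by blast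
  \<comment> \<open>The radius is at least 2 because exp (h r) equals r^\<delta>(r) only for r > 1;
    at r = 1 the exponent is defined by a limit.\<close>
  have "M * (if real CARD('n) \<noteq> 2 * (real k + 2 * \<gamma> / real k + 4)
      then r powr delta CARD('n) k w r else ln r) \<le> \<bar>u x\<bar>" if "r \<ge> max r0 2" "norm x = r" for r x
    using lower[of r] that weight.r_powr_delta[OF weight, of r] u[of x] by (simp split: if_splits)
  then show ?thesis using \<open>M > 0\<close>
    by (intro exI[of _ M] conjI exI[of _ "max r0 2"]) auto
qed

end
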